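(* Let $\Theta=(\theta_{jk})$ be a real $n\times n$ matrix with invertible diagonal part $\mathrm{diag}\,\Theta$, and let $\vec\psi=\mathrm{Col}(\psi_1,\dots,\psi_n)$ with $\psi_j\in L^2(I_j)$ real-valued. If the equation $\chi\Theta\mathcal H\vec\varphi=\vec\psi$ is solvable (i.e. has a solution $\vec\varphi\in L^2(I)$), then there exists a unique constant vector $\vec c\in\mathbb R^n$ such that $\vec\psi-\vec c\in\mathcal R$.
   Context: Let $n\in\mathbb N$, $I_j=[\alpha_j,\beta_j]$ with $-\infty<\alpha_1<\beta_1<\alpha_2<\dots<\alpha_n<\beta_n<\infty$, $I=\bigcup_{j=1}^n I_j$. Let $\chi_j$ be the characteristic function of (or restriction to) $I_j$, $\chi=\mathrm{diag}(\chi_1,\dots,\chi_n)$. For $\phi\in L^2(I_j)$ put $(\mathcal H_j\phi)(z)=\frac1\pi\int_{I_j}\frac{\phi(\zeta)}{\zeta-z}d\zeta$ (principal value if $z\in I_j$), and $\mathcal H=\mathrm{diag}(\mathcal H_1,\dots,\mathcal H_n)$. A vector $\vec\varphi=\mathrm{Col}(\varphi_1,\dots,\varphi_n)$ with $\varphi_j\in L^2(I_j)$ is identified with the function $\varphi\in L^2(I)$ equal to $\varphi_j$ on $I_j$. The equation $\chi\Theta\mathcal H\vec\varphi=\vec\psi$ means $\sum_k\theta_{mk}(\mathcal H_k\varphi_k)(z)=\psi_m(z)$ for a.e. $z\in I_m$, $m=1,\dots,n$. $\mathcal R\subset L^2(I)$ is the range of $\chi\mathcal H=\mathrm{diag}(\chi_1\mathcal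 H_1,\dots,\chi_n\mathcal H_n)$ on $L^2(I)$. A constant vector $\vec c$ is regarded as the element of $L^2(I)$ equal to $c_j$ on $I_j$. *)

theory Defs
  imports "HOL-Analysis.Analysis"
begin

text \<open>
  Vectors of functions \<open>Col(\<phi>\<^sub>1, \<dots>, \<phi>\<^sub>n)\<close>, with \<open>\<phi>\<^sub>j\<close> living on \<open>{\<alpha> j..\<beta> j}\<close>, are families
  \<open>\<phi> :: 'n \<Rightarrow> real \<Rightarrow> complex\<close>; the values of \<open>\<phi> j\<close> outside \<open>{\<alpha> j..\<beta> j}\<close> are never used. Elements
  of \<open>L\<^sup>2\<close> are represented by square-integrable functions, and equalities between them are
  required almost everywhere. The index type is a finite linear order, so that the intervals can
  be numbered from left to right.
\<close>

definition ordered_intervals :: "('n::{finite,linorder} \<Rightarrow> real) \<Rightarrow> ('n \<Rightarrow> real) \<Rightarrow> bool" where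
  "ordered_intervals \<alpha> \<beta> \<longleftrightarrow> (\<forall>j. \<alpha> j < \<beta> j) \<and> (\<forall>j k. j < k \<longrightarrow> \<beta> j < \<alpha> k)"

definition L2_on :: "real set \<Rightarrow> (real \<Rightarrow> complex) set" where
  "L2_on S = {\<phi>. set_borel_measurable lebesgue S \<phi> \<and>
                 set_integrable lebesgue S (\<lambda>x. (norm (\<phi> x))\<^sup>2)}"

definition L2_vec :: "('n \<Rightarrow> real) \<Rightarrow> ('n \<Rightarrow> real) \<Rightarrow> ('n \<Rightarrow> real \<Rightarrow> complex) set" where
  "L2_vec \<alpha> \<beta> = {\<phi>. \<forall>j. \<phi> j \<in> L2_on {\<alpha> j..\<beta> j}}"

definition truncated_cauchy_integral ::
  "real \<Rightarrow> real \<Rightarrow> (real \<Rightarrow> complex) \<Rightarrow> real \<Rightarrow> real \<Rightarrow> complex" where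
  "truncated_cauchy_integral a b \<phi> z \<epsilon> =
     (LINT \<zeta>:{a..b} - {z - \<epsilon><..<z + \<epsilon>}|lebesgue. \<phi> \<zeta> / of_real (\<zeta> - z))"

definition hilbert :: "real \<Rightarrow> real \<Rightarrow> (real \<Rightarrow> complex) \<Rightarrow> real \<Rightarrow> complex" where
  "hilbert a b \<phi> z = of_real (1 / pi) *
     (if z \<in> {a..b} then Lim (at_right 0) (truncated_cauchy_integral a b \<phi> z)
      else (LINT \<zeta>:{a..b}|lebesgue. \<phi> \<zeta> / of_real (\<zeta> - z)))"

text \<open>
  The constant \<^const>\<open>Lim\<close> is unspecified if the limit does not exist. The following predicate
  says that the principal value does exist, so that \<^term>\<open>hilbert a b \<phi> z\<close> is meaningful. For a
  square-integrable \<open>\<phi>\<close> it holds at almost every \<open>z\<close>, so requiring it almost everywhere, as below,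
  is no restriction.
\<close>

definition hilbert_exists :: "real \<Rightarrow> real \<Rightarrow> (real \<Rightarrow> complex) \<Rightarrow> real \<Rightarrow> bool" where
  "hilbert_exists a b \<phi> z \<longleftrightarrow>
     (z \<in> {a..b} \<longrightarrow> (\<exists>w. (truncated_cauchy_integral a b \<phi> z \<longlongrightarrow> w) (at_right 0)))"

definition solves_hilbert_system ::
  "real ^ 'n ^ 'n \<Rightarrow> ('n \<Rightarrow> real) \<Rightarrow> ('n \<Rightarrow> real) \<Rightarrow>
     ('n \<Rightarrow> real \<Rightarrow> complex) \<Rightarrow> ('n \<Rightarrow> real \<Rightarrow> complex) \<Rightarrow> bool" where
  "solves_hilbert_system \<Theta> \<alpha> \<beta> \<psi> \<phi> \<longleftrightarrow>
     \<phi> \<in> L2_vec \<alpha> \<beta> \<and>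
     (\<forall>m. AE z in lebesgue. z \<in> {\<alpha> m..\<beta> m} \<longrightarrow>
        (\<forall>k. hilbert_exists (\<alpha> k) (\<beta> k) (\<phi> k) z) \<and>
        (\<Sum>k\<in>UNIV. of_real (\<Theta> $ m $ k) * hilbert (\<alpha> k) (\<beta> k) (\<phi> k) z) = \<psi> m z)"

definition hilbert_range ::
  "('n \<Rightarrow> real) \<Rightarrow> ('n \<Rightarrow> real) \<Rightarrow> ('n \<Rightarrow> real \<Rightarrow> complex) set" where
  "hilbert_range \<alpha> \<beta> = {f \<in> L2_vec \<alpha> \<beta>. \<exists>\<phi> \<in> L2_vec \<alpha> \<beta>.
     \<forall>j. AE z in lebesgue. z \<in> {\<alpha> j..\<beta> j} \<longrightarrow>
        hilbert_exists (\<alpha> j) (\<beta> j) (\<phi> j) z \<and> hilbert (\<alpha> j) (\<beta> j) (\<phi> j) z = f j z}"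

definition diag_part :: "real ^ 'n ^ 'n \<Rightarrow> real ^ 'n ^ 'n" where
  "diag_part A = (\<chi> i j. if i = j then A $ i $ j else 0)"

end

theory Submission
  imports Defs
begin

text \<open>
  The term \<open>\<theta>\<^sub>m\<^sub>k \<H>\<^sub>k \<phi>\<^sub>k\<close> with \<open>k \<noteq> m\<close> of the \<open>m\<close>-th equation is a superposition of the functions
  \<open>1 / (w - z)\<close> with \<open>w\<close> in the disjoint interval \<open>I\<^sub>k\<close>. On \<open>{a..b}\<close> the finite Hilbert transform of
  \<open>sqrt ((x - a) (b - x)) / ((x - w) r(w))\<close>, where \<open>r(w) = \<plusminus> sqrt ((w - a) (w - b))\<close>, equals
  \<open>1 / (w - z) - 1 / r(w)\<close>, so each such term is in the range up to a constant. This gives existence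
  of \<open>c\<close>; as \<open>\<Theta>\<close> and \<open>\<psi>\<close> are real, one may work with real parts throughout.

  For uniqueness, suppose that a constant \<open>c\<close> is the transform of some \<open>f\<close> in \<open>L\<^sup>2\<close>. Pairing with
  \<open>sqrt ((x - a) (b - x)) / (x - w)\<close> and letting \<open>w\<close> tend to an endpoint \<open>p\<close> from outside gives
  \<open>pi c ((a + b) / 2 - p) = \<integral> f\<close> for both \<open>p = a\<close> and \<open>p = b\<close>, so \<open>c = 0\<close>.
  The antisymmetry of the transform used in this pairing follows from that of the truncated
  integrals, because these are bounded in \<open>L\<^sup>2\<close> uniformly in the truncation, and almost everywhere
  convergence plus boundedness in \<open>L\<^sup>2\<close> implies weak convergence.
\<close>

subsection \<open>Principal value integrals of the semicircle function\<close>

text \<open>Uniqueness is a borderline matter. For \<open>c \<noteq> 0\<close> the functions whose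
  transform is the constant \<open>c\<close> are affine functions divided by
  \<open>arch a b\<close>. The numerator cannot vanish at both ends, so an inverse square root
  singularity remains, which lies in L^p for every p < 2 and just misses L2. Hence both endpoints
  are tested, and the limit there is delicate: \<open>outer_root a b w / (w - z)\<close> tends to 0
  pointwise as \<open>w\<close> approaches an endpoint, but its L2 norm stays constant, so only weak
  convergence can hold. A similar obstacle occurs in the pairing itself: the truncated integrals of
  a general \<open>f\<close> come with no integrable majorant, so dominated convergence does not
  apply to them directly. For the uniform L2 bound that replaces it, the sharply cut kernel is
  compared with the real and imaginary parts of \<open>1 / (y - i e)\<close>. The L2 norms of the
  smoothed transforms are quadratic forms in \<open>f\<close> with an explicit kernel, to which
  Schur's test applies with a constant free of \<open>e\<close>.\<close>

definition arch :: "real \<Rightarrow> real \<Rightarrow> real \<Rightarrow> real" where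
  "arch a b x = sqrt ((x - a) * (b - x))"

lemma arch_square: "x \<in> {a..b} \<Longrightarrow> (arch a b x)\<^sup>2 = (x - a) * (b - x)"
  by (auto simp: arch_def)

lemma arch_pos: "x \<in> {a<..<b} \<Longrightarrow> arch a b x > 0"
  by (auto simp: arch_def)

lemma continuous_on_arch: "continuous_on S (arch a b)"
  unfolding arch_def by (intro continuous_intros)

lemma DERIV_arch:
  assumes "x \<in> {a<..<b}"
  shows "(arch a b has_real_derivative (a + b - 2 * x) / (2 * arch a b x)) (at x)"
proof -
  have "(x - a) * (b - x) > 0" using assms by auto
  then show ?thesis unfolding arch_def
    by (auto intro!: derivative_eq_intros simp: field_simps)
qed

lemma DERIV_arcsin_interval:
  assumes "x \<in> {a<..<b}"
  shows "((\<lambda>x. arcsin ((2 * x - a - b) / (b - a))) has_real_derivative 1 / arch a b x) (at x)"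
proof -
  have ab: "a < b" using assms by auto
  have 1: "-1 < (2 * x - a - b) / (b - a)" "(2 * x - a - b) / (b - a) < 1"
    using assms by (auto simp: field_simps)
  have "1 - ((2 * x - a - b) / (b - a))\<^sup>2 = (2 / (b - a))\<^sup>2 * ((x - a) * (b - x))"
  proof -
    have "1 - ((2 * x - a - b) / (b - a))\<^sup>2 = ((b - a)\<^sup>2 - (2 * x - a - b)\<^sup>2) / (b - a)\<^sup>2"
      using ab by (simp add: power_divide divide_simps)
    also have "(b - a)\<^sup>2 - (2 * x - a - b)\<^sup>2 = 4 * ((x - a) * (b - x))"
      by algebra
    finally show ?thesis by (simp add: power_divide)
  qed
  then have 2: "sqrt (1 - ((2 * x - a - b) / (b - a))\<^sup>2) = 2 / (b - a) * arch a b x"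
    using ab by (simp add: real_sqrt_mult arch_def)
  have 3: "((\<lambda>x. (2 * x - a - b) / (b - a)) has_real_derivative 2 / (b - a)) (at x)"
    by (rule DERIV_cdivide) (auto intro!: derivative_eq_intros)
  have "inverse (2 / (b - a) * arch a b x) * (2 / (b - a)) = 1 / arch a b x"
    using ab arch_pos[OF assms] by (simp add: divide_simps)
  then show ?thesis
    using DERIV_chain2[OF DERIV_arcsin[OF 1] 3] unfolding 2 by simp
qed

text \<open>An antiderivative of \<open>arch a b x / (x - z)\<close>, without its singular part \<open>arch a b z * ln \<bar>x - z\<bar>\<close>.\<close>

definition pv_prim :: "real \<Rightarrow> real \<Rightarrow> real \<Rightarrow> real \<Rightarrow> real" where
  "pv_prim a b z x = arch a b x + ((a + b) / 2 - z) * arcsin ((2 * x - a - b) / (b - a))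
     - arch a b z * ln ((x - a) * (b - z) + (b - x) * (z - a) + 2 * arch a b x * arch a b z)"

text \<open>The argument of the logarithm is the square of
  \<open>sqrt ((x - a) * (b - z)) + sqrt ((b - x) * (z - a))\<close>. It stays positive at the
  endpoints and at \<open>x = z\<close>, so \<open>pv_prim\<close> is continuous on all of
  \<open>{a..b}\<close>.\<close>

lemma pv_prim_log_pos:
  assumes "z \<in> {a<..<b}" "x \<in> {a..b}"
  shows "(x - a) * (b - z) + (b - x) * (z - a) + 2 * arch a b x * arch a b z > 0"
proof -
  have "(x - a) * (b - z) + (b - x) * (z - a) > 0"
  proof (cases "x = a")
    case False
    then show ?thesis using assms by (intro add_pos_nonneg mult_pos_pos mult_nonneg_nonneg) auto
  qed (use assms in auto)
  moreover have "arch a b x * arch a b z \<ge> 0" using assms by (auto simp: arch_def)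
  ultimately show ?thesis by simp
qed

lemma continuous_on_pv_prim:
  assumes "z \<in> {a<..<b}"
  shows "continuous_on {a..b} (pv_prim a b z)"
proof -
  have *: "(x - a) * (b - z) + (b - x) * (z - a) + 2 * arch a b x * arch a b z \<noteq> 0" if "x \<in> {a..b}" for x
    using pv_prim_log_pos[OF assms that] by simp
  show ?thesis unfolding pv_prim_def
    by (intro continuous_intros continuous_on_arcsin continuous_on_subset[OF continuous_on_arch] ballI)
       (use assms * in \<open>auto simp: field_simps\<close>)
qed

text \<open>The term \<open>ln ((x - z)\<^sup>2) / 2\<close> is \<open>ln \<bar>x - z\<bar>\<close>
  in a form that is differentiated in the same way on both sides of \<open>z\<close>.\<close>

lemma DERIV_pv_prim:
  assumes z: "z \<in> {a<..<b}" and x: "x \<in> {a<..<b}" and "x \<noteq> z"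
  shows "((\<lambda>x. pv_prim a b z x + arch a b z * (ln ((x - z)\<^sup>2) / 2))
           has_real_derivative arch a b x / (x - z)) (at x)"
proof -
  define R Z where "R = arch a b x" and "Z = arch a b z"
  define B where "B = (x - a) * (b - z) + (b - x) * (z - a) + 2 * R * Z"
  have B: "B > 0" unfolding B_def R_def Z_def using pv_prim_log_pos[OF z] x by auto
  have R: "R > 0" "R * R = (x - a) * (b - x)" and Z: "Z * Z = (z - a) * (b - z)"
    using arch_pos[OF x] arch_square[of x a b] arch_square[of z a b] x z
    by (auto simp: R_def Z_def power2_eq_square)
  have xz: "x - z \<noteq> 0" using assms by simp
  have "((\<lambda>x. (x - a) * (b - z) + (b - x) * (z - a) + 2 * arch a b x * arch a b z) has_real_derivative
      (a + b - 2 * z + Z * (a + b - 2 * x) / R)) (at x)"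
    using R(1) by (auto intro!: derivative_eq_intros DERIV_arch[OF x] simp: R_def Z_def field_simps)
  from DERIV_chain2[OF DERIV_ln_divide this] B
  have 1: "((\<lambda>x. ln ((x - a) * (b - z) + (b - x) * (z - a) + 2 * arch a b x * arch a b z)) has_real_derivative
      (a + b - 2 * z + Z * (a + b - 2 * x) / R) / B) (at x)"
    by (simp add: B_def R_def Z_def field_simps)
  have "(x - z)\<^sup>2 > 0" using xz by simp
  then have 2: "((\<lambda>x. ln ((x - z)\<^sup>2) / 2) has_real_derivative 1 / (x - z)) (at x)"
    using xz by (auto intro!: derivative_eq_intros simp: field_simps power2_eq_square)
  have key: "1 / (x - z) - (a + b - 2 * z + Z * (a + b - 2 * x) / R) / B = Z / ((x - z) * R)"
  proof -
    have "R * B - (x - z) * (R * (a + b - 2 * z) + Z * (a + b - 2 * x)) = Z * B"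
      using R(2) Z unfolding B_def by algebra
    moreover have "(a + b - 2 * z + Z * (a + b - 2 * x) / R) / B = (R * (a + b - 2 * z) + Z * (a + b - 2 * x)) / (R * B)"
      using R B by (simp add: field_simps)
    ultimately have "1 / (x - z) - (a + b - 2 * z + Z * (a + b - 2 * x) / R) / B = Z * B / ((x - z) * (R * B))"
      using xz R B by (simp add: field_simps)
    then show ?thesis using B by simp
  qed
  \<comment> \<open>By \<open>key\<close> the two logarithms together contribute
    \<open>Z\<^sup>2 / ((x - z) * R)\<close>; what is left is the identity
    \<open>R\<^sup>2 - Z\<^sup>2 = (a + b - x - z) * (x - z)\<close>.\<close>
  have "(a + b - 2 * x) / (2 * R) + ((a + b) / 2 - z) * (1 / R) - Z * ((a + b - 2 * z + Z * (a + b - 2 * x) / R) / B) + Z * (1 / (x - z))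
     = (a + b - x - z) / R + Z * (Z / ((x - z) * R))"
    unfolding key[symmetric] using R by (simp add: field_simps)
  also have "\<dots> = ((a + b - x - z) * (x - z) + Z * Z) / ((x - z) * R)"
    using R xz by (simp add: field_simps)
  also have "(a + b - x - z) * (x - z) + Z * Z = R * R"
    unfolding R(2) Z by algebra
  finally have eq: "(a + b - 2 * x) / (2 * R) + ((a + b) / 2 - z) * (1 / R) - Z * ((a + b - 2 * z + Z * (a + b - 2 * x) / R) / B) + Z * (1 / (x - z)) = R / (x - z)"
    using R(1) by simp
  show ?thesis unfolding pv_prim_def eq[symmetric, unfolded R_def Z_def]
    by (intro DERIV_add DERIV_diff DERIV_cmult DERIV_arch[OF x] DERIV_arcsin_interval[OF x] 1[unfolded R_def Z_def] 2)
qed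

section \<open>Truncated principal value integrals\<close>

definition kern :: "real \<Rightarrow> real \<Rightarrow> real" where
  "kern e y = (if \<bar>y\<bar> < e then 0 else 1 / y)"

text \<open>Cutting the kernel instead of the domain keeps all integrals on one finite measure
  space, with a kernel that is bounded and odd.\<close>

definition trunc_int :: "real \<Rightarrow> real \<Rightarrow> (real \<Rightarrow> real) \<Rightarrow> real \<Rightarrow> real \<Rightarrow> real" where
  "trunc_int a b f z e = (LINT x|lebesgue_on {a..b}. f x * kern e (x - z))"

lemma kern_minus: "kern e (- y) = - kern e y"
  by (simp add: kern_def)

lemma abs_kern_le: "e > 0 \<Longrightarrow> \<bar>kern e y\<bar> \<le> 1 / e"
  by (auto simp: kern_def field_simps)

lemma borel_measurable_kern [measurable]: "kern e \<in> borel_measurable borel"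
  unfolding kern_def by measurable

lemma borel_measurable_lebesgue_on_borel:
  fixes f :: "real \<Rightarrow> real"
  shows "f \<in> borel_measurable borel \<Longrightarrow> f \<in> borel_measurable (lebesgue_on S)"
  by (intro measurable_restrict_space1 measurable_completion) (auto simp: measurable_lborel2)

lemma finite_measure_interval: "finite_measure (lebesgue_on {a..b::real})"
  by (intro finite_measure_lebesgue_on) (auto simp: lmeasurable_interval)

lemma integrable_bounded_interval:
  fixes f :: "real \<Rightarrow> real"
  assumes "f \<in> borel_measurable (lebesgue_on {a..b})" "\<And>x. x \<in> {a..b} \<Longrightarrow> \<bar>f x\<bar> \<le> B"
  shows "integrable (lebesgue_on {a..b}) f"
proof -
  interpret finite_measure "lebesgue_on {a..b}" by (rule finite_measure_interval)
  show ?thesis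
    by (rule integrable_const_bound[where B = B]) (use assms in \<open>auto intro!: AE_I2\<close>)
qed

lemma integrable_mult_bounded_interval:
  fixes f g :: "real \<Rightarrow> real"
  assumes "integrable (lebesgue_on {a..b}) f" "g \<in> borel_measurable (lebesgue_on {a..b})"
    and "\<And>x. x \<in> {a..b} \<Longrightarrow> \<bar>g x\<bar> \<le> B"
  shows "integrable (lebesgue_on {a..b}) (\<lambda>x. f x * g x)"
proof (rule Bochner_Integration.integrable_bound)
  show "integrable (lebesgue_on {a..b}) (\<lambda>x. \<bar>B\<bar> * f x)" using assms(1) by simp
  show "(\<lambda>x. f x * g x) \<in> borel_measurable (lebesgue_on {a..b})"
    using assms(1,2) by (auto dest: borel_measurable_integrable)
  show "AE x in lebesgue_on {a..b}. norm (f x * g x) \<le> norm (\<bar>B\<bar> * f x)"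
  proof (rule AE_I2)
    fix x assume "x \<in> space (lebesgue_on {a..b})"
    then have "\<bar>g x\<bar> \<le> \<bar>B\<bar>" using assms(3)[of x] by auto
    then show "norm (f x * g x) \<le> norm (\<bar>B\<bar> * f x)"
      by (simp add: abs_mult mult.commute[of "\<bar>f x\<bar>"] mult_right_mono)
  qed
qed

lemma integrable_times_kern:
  assumes "integrable (lebesgue_on {a..b}) f" "e > 0"
  shows "integrable (lebesgue_on {a..b}) (\<lambda>x. f x * kern e (x - z))"
  using assms(1)
  by (rule integrable_mult_bounded_interval)
     (auto intro: abs_kern_le[OF assms(2)] borel_measurable_lebesgue_on_borel)

lemma integrable_arch: "integrable (lebesgue_on {a..b}) (arch a b)"
  by (rule continuous_imp_integrable_real[OF continuous_on_arch])

lemma trunc_int_arch: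
  assumes "0 < e" "e < z - a" "e < b - z"
  shows "trunc_int a b (arch a b) z e = pi * ((a + b) / 2 - z) + pv_prim a b z (z - e) - pv_prim a b z (z + e)"
proof -
  have z: "z \<in> {a<..<b}" and ab: "a < b" using assms by auto
  define A where "A = (\<lambda>x. pv_prim a b z x + arch a b z * (ln ((x - z)\<^sup>2) / 2))"
  have cA: "continuous_on S A" if "S \<subseteq> {a..b} - {z}" for S
    unfolding A_def using that
    by (intro continuous_intros continuous_on_subset[OF continuous_on_pv_prim[OF z]]) auto
  have dA: "(A has_vector_derivative arch a b x / (x - z)) (at x)" if "x \<in> {a<..<b}" "x \<noteq> z" for x
    using DERIV_pv_prim[OF z that] unfolding A_def by (simp add: has_real_derivative_iff_has_vector_derivative)
  let ?f = "\<lambda>x. arch a b x * kern e (x - z)"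
  have 1: "(?f has_integral A (z - e) - A a) {a..z - e}"
  proof (rule has_integral_eq[OF _ fundamental_theorem_of_calculus_interior])
    show "arch a b x / (x - z) = ?f x" if "x \<in> {a..z - e}" for x
      using that assms by (auto simp: kern_def)
  qed (use assms in \<open>auto intro!: cA dA\<close>)
  have 3: "(?f has_integral A b - A (z + e)) {z + e..b}"
  proof (rule has_integral_eq[OF _ fundamental_theorem_of_calculus_interior])
    show "arch a b x / (x - z) = ?f x" if "x \<in> {z + e..b}" for x
      using that assms by (auto simp: kern_def)
  qed (use assms in \<open>auto intro!: cA dA\<close>)
  \<comment> \<open>At distance exactly \<open>e\<close> the kernel has the value
    \<open>1 / y\<close> and not 0, whence the two exceptional points.\<close>
  have 2: "(?f has_integral 0) {z - e..z + e}"
    by (rule has_integral_spike_finite[where S = "{z - e, z + e}" and f = "\<lambda>_. 0"])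
       (auto simp: kern_def)
  have "(?f has_integral (A (z - e) - A a) + 0) {a..z + e}"
    by (rule has_integral_combine[OF _ _ 1 2]) (use assms in auto)
  then have "(?f has_integral (A (z - e) - A a + 0) + (A b - A (z + e))) {a..b}"
    by (rule has_integral_combine[OF _ _ _ 3, rotated 2]) (use assms in auto)
  then have "trunc_int a b (arch a b) z e = A (z - e) - A a + (A b - A (z + e))"
    unfolding trunc_int_def
    by (subst lebesgue_integral_eq_integral[OF integrable_times_kern[OF integrable_arch assms(1)]])
       (auto dest: integral_unique)
  \<comment> \<open>The logarithm of \<open>(x - z)\<^sup>2\<close> takes the same value at
    \<open>z - e\<close> and \<open>z + e\<close>: this is the cancellation behind the principal
    value.\<close>
  moreover have "A (z - e) - A (z + e) = pv_prim a b z (z - e) - pv_prim a b z (z + e)"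
    by (simp add: A_def)
  \<comment> \<open>At both ends the logarithms leave \<open>- arch a b z * ln (b - a)\<close>,
    which cancels; only the jump of the arcsine from \<open>- pi / 2\<close> to
    \<open>pi / 2\<close> remains.\<close>
  moreover have "A b - A a = pi * ((a + b) / 2 - z)"
  proof -
    define c where "c = (a + b) / 2 - z"
    have u: "(2 * a - a - b) / (b - a) = -1" "(2 * b - a - b) / (b - a) = 1"
      using ab by (auto simp: field_simps)
    have e: "arch a b a = 0" "arch a b b = 0" by (auto simp: arch_def)
    have pos: "b - z > 0" "z - a > 0" "b - a > 0" using z by auto
    have l: "ln ((b - z)\<^sup>2) = 2 * ln (b - z)" "ln ((a - z)\<^sup>2) = 2 * ln (z - a)"
      "ln ((b - a) * (b - z)) = ln (b - a) + ln (b - z)" "ln ((b - a) * (z - a)) = ln (b - a) + ln (z - a)"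
      using pos by (auto simp: ln_realpow ln_mult power2_commute[of a z])
    have "A b = c * (pi / 2) - arch a b z * (ln (b - a) + ln (b - z)) + arch a b z * ln (b - z)"
      unfolding A_def pv_prim_def u e c_def by (simp add: l)
    moreover have "A a = c * (- pi / 2) - arch a b z * (ln (b - a) + ln (z - a)) + arch a b z * ln (z - a)"
      unfolding A_def pv_prim_def u e c_def by (simp add: l)
    ultimately have "A b - A a = pi * c" by (simp add: algebra_simps)
    then show ?thesis by (simp add: c_def)
  qed
  ultimately show ?thesis by linarith
qed

text \<open>Continuity of \<open>pv_prim\<close> at \<open>z\<close> cancels the two boundary terms.
  The result is the classical fact that the transform of a semicircle is affine inside its
  support.\<close>

lemma tendsto_trunc_int_arch:
  assumes "z \<in> {a<..<b}"
  shows "(trunc_int a b (arch a b) z \<longlongrightarrow> pi * ((a + b) / 2 - z)) (at_right 0)"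
proof -
  have "isCont (pv_prim a b z) z"
    using continuous_on_interior[OF continuous_on_pv_prim[OF assms]] assms by simp
  then have c: "((\<lambda>e. pv_prim a b z (g e)) \<longlongrightarrow> pv_prim a b z z) (at_right 0)"
    if "(g \<longlongrightarrow> z) (at_right 0)" for g :: "real \<Rightarrow> real"
    using isCont_tendsto_compose that by blast
  have "((\<lambda>e. pi * ((a + b) / 2 - z) + pv_prim a b z (z - e) - pv_prim a b z (z + e))
     \<longlongrightarrow> pi * ((a + b) / 2 - z) + pv_prim a b z z - pv_prim a b z z) (at_right 0)"
    by (intro tendsto_intros c) (auto intro!: tendsto_eq_intros)
  moreover have "\<forall>\<^sub>F e in at_right 0. trunc_int a b (arch a b) z e =
      pi * ((a + b) / 2 - z) + pv_prim a b z (z - e) - pv_prim a b z (z + e)"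
    using eventually_at_right_real[of 0 "min (z - a) (b - z)"] assms
    by (auto elim!: eventually_mono intro!: trunc_int_arch)
  ultimately show ?thesis by (simp add: filterlim_cong)
qed

text \<open>The branch of \<open>sqrt ((w - a) * (w - b))\<close> on the complement of \<open>{a..b}\<close> that behaves like \<open>w\<close> at infinity.\<close>

definition outer_root :: "real \<Rightarrow> real \<Rightarrow> real \<Rightarrow> real" where
  "outer_root a b w = (if w > b then 1 else -1) * sqrt ((w - a) * (w - b))"

lemma outer_root_square: "a \<le> b \<Longrightarrow> w \<notin> {a..b} \<Longrightarrow> (outer_root a b w)\<^sup>2 = (w - a) * (w - b)"
  by (auto simp: outer_root_def power_mult_distrib mult_nonneg_nonneg mult_nonpos_nonpos)

lemma outer_root_nonzero: "a \<le> b \<Longrightarrow> w \<notin> {a..b} \<Longrightarrow> outer_root a b w \<noteq> 0"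
  by (auto simp: outer_root_def)

lemma borel_measurable_outer_root [measurable]: "outer_root a b \<in> borel_measurable borel"
  unfolding outer_root_def by measurable

lemma has_integral_arch_over_diff:
  assumes ab: "a < b" and w: "w \<notin> {a..b}"
  shows "((\<lambda>x. arch a b x / (x - w)) has_integral pi * ((a + b) / 2 - w + outer_root a b w)) {a..b}"
proof -
  define E where "E = outer_root a b w"
  have E2: "E * E = (w - a) * (w - b)" and "E \<noteq> 0"
    using outer_root_square[of a b w] outer_root_nonzero[of a b w] ab w by (auto simp: E_def power2_eq_square)
  have pos: "(w - a) * (w - b) > 0" using \<open>E \<noteq> 0\<close> E2 by (metis not_real_square_gt_zero)
  \<comment> \<open>The Moebius map that sends \<open>a\<close> to -1, \<open>b\<close> to 1 and
    \<open>w\<close> to infinity. Since \<open>w\<close> lies outside \<open>{a..b}\<close>, the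
    logarithmic part of the antiderivative is replaced by the arcsine of this map.\<close>
  define u where "u = (\<lambda>x. ((x - a) * (b - w) + (b - x) * (w - a)) / ((b - a) * (x - w)))"
  have usq: "1 - (u x)\<^sup>2 = 4 * (x - a) * (b - x) * (E * E) / ((b - a) * (x - w))\<^sup>2" if "x \<in> {a..b}" for x
  proof -
    have "x - w \<noteq> 0" "b - a \<noteq> 0" using that w ab by auto
    then have "1 - (u x)\<^sup>2 = (((b - a) * (x - w))\<^sup>2 - ((x - a) * (b - w) + (b - x) * (w - a))\<^sup>2) / ((b - a) * (x - w))\<^sup>2"
      by (simp add: u_def power_divide divide_simps)
    also have "((b - a) * (x - w))\<^sup>2 - ((x - a) * (b - w) + (b - x) * (w - a))\<^sup>2 = 4 * (x - a) * (b - x) * (E * E)"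
      unfolding E2 by algebra
    finally show ?thesis .
  qed
  have u1: "-1 \<le> u x \<and> u x \<le> 1" if "x \<in> {a..b}" for x
  proof -
    have "1 - (u x)\<^sup>2 \<ge> 0" unfolding usq[OF that]
      using that by (intro divide_nonneg_nonneg mult_nonneg_nonneg[of "4 * (x - a) * (b - x)"]) auto
    then have "\<bar>u x\<bar> \<le> 1" by (simp add: abs_square_le_1)
    then show ?thesis by linarith
  qed
  have cu: "continuous_on {a..b} u" unfolding u_def
    using w ab by (intro continuous_intros) auto
  define A where "A = (\<lambda>x. arch a b x + ((a + b) / 2 - w) * arcsin ((2 * x - a - b) / (b - a)) + E * arcsin (u x))"
  have cA: "continuous_on {a..b} A"
    unfolding A_def using ab u1
    by (intro continuous_intros continuous_on_arcsin cu continuous_on_subset[OF continuous_on_arch] ballI)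
       (auto simp: field_simps)
  have dA: "(A has_vector_derivative arch a b x / (x - w)) (at x)" if x: "x \<in> {a<..<b}" for x
  proof -
    define R where "R = arch a b x"
    have R: "R > 0" "R * R = (x - a) * (b - x)"
      using arch_pos[OF x] arch_square[of x a b] x by (auto simp: R_def power2_eq_square)
    have xw: "x - w \<noteq> 0" using x w by auto
    have usq': "1 - (u x)\<^sup>2 = (2 * R * E / ((b - a) * (x - w)))\<^sup>2"
      using usq[of x] x R(2) by (simp add: power_divide power_mult_distrib) (simp add: power2_eq_square)
    then have sq: "sqrt (1 - (u x)\<^sup>2) = \<bar>2 * R * E / ((b - a) * (x - w))\<bar>"
      by simp
    also have "\<dots> = - 2 * R * E / ((b - a) * (x - w))"
    proof -
      \<comment> \<open>For \<open>w > b\<close> the root is positive and \<open>x - w\<close>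
        negative, for \<open>w < a\<close> the other way round; the branch in
        \<open>outer_root\<close> makes one formula serve both sides.\<close>
      have "E / (x - w) < 0"
        using \<open>E \<noteq> 0\<close> w x ab pos unfolding E_def outer_root_def
        by (auto simp: divide_simps zero_less_mult_iff)
      then have "(2 * R / (b - a)) * (E / (x - w)) < 0" using R ab by (intro mult_pos_neg) auto
      then have "2 * R * E / ((b - a) * (x - w)) < 0" by simp
      then show ?thesis by (rule abs_of_neg[THEN trans]) simp
    qed
    finally have sq: "sqrt (1 - (u x)\<^sup>2) = - 2 * R * E / ((b - a) * (x - w))" .
    have "2 * R * E / ((b - a) * (x - w)) \<noteq> 0" using \<open>E \<noteq> 0\<close> R(1) xw ab by simp
    then have "1 - (u x)\<^sup>2 > 0" unfolding usq' by (rule zero_less_power2[THEN iffD2])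
    then have "\<bar>u x\<bar> < 1" by (simp add: abs_square_less_1)
    then have ul: "-1 < u x" "u x < 1" by auto
    have du: "(u has_real_derivative (2 * (E * E)) / ((b - a) * (x - w)\<^sup>2)) (at x)"
    proof -
      have "((\<lambda>x. (x - a) * (b - w) + (b - x) * (w - a)) has_real_derivative (a + b - 2 * w)) (at x)"
        by (auto intro!: derivative_eq_intros)
      moreover have "((\<lambda>x. (b - a) * (x - w)) has_real_derivative (b - a)) (at x)"
        by (auto intro!: derivative_eq_intros)
      ultimately have "(u has_real_derivative ((a + b - 2 * w) * ((b - a) * (x - w)) - ((x - a) * (b - w) + (b - x) * (w - a)) * (b - a)) / (((b - a) * (x - w)) * ((b - a) * (x - w)))) (at x)"
        unfolding u_def by (rule DERIV_divide) (use xw ab in auto)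
      moreover have "((a + b - 2 * w) * ((b - a) * (x - w)) - ((x - a) * (b - w) + (b - x) * (w - a)) * (b - a)) = (b - a) * (2 * (E * E))"
        unfolding E2 by algebra
      moreover have "(b - a) * (2 * (E * E)) / (((b - a) * (x - w)) * ((b - a) * (x - w))) = 2 * (E * E) / ((b - a) * (x - w)\<^sup>2)"
        using ab xw by (simp add: divide_simps power2_eq_square)
      ultimately show ?thesis by (simp only:)
    qed
    have das: "((\<lambda>x. arcsin (u x)) has_real_derivative - E / ((x - w) * R)) (at x)"
    proof -
      have "inverse (- 2 * R * E / ((b - a) * (x - w))) * (2 * (E * E) / ((b - a) * (x - w)\<^sup>2)) = - E / ((x - w) * R)"
        using R ab xw \<open>E \<noteq> 0\<close> by (simp add: divide_simps power2_eq_square)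
      then show ?thesis using DERIV_chain2[OF DERIV_arcsin[OF ul] du] unfolding sq by simp
    qed
    have "(A has_real_derivative ((a + b - 2 * x) / (2 * R) + ((a + b) / 2 - w) * (1 / R) + E * (- E / ((x - w) * R)))) (at x)"
      unfolding A_def R_def
      by (intro DERIV_add DERIV_cmult DERIV_arch[OF x] DERIV_arcsin_interval[OF x] das[unfolded R_def])
    moreover have "(a + b - 2 * x) / (2 * R) + ((a + b) / 2 - w) * (1 / R) + E * (- E / ((x - w) * R)) = R / (x - w)"
    proof -
      have "(a + b - 2 * x) / (2 * R) + ((a + b) / 2 - w) * (1 / R) + E * (- E / ((x - w) * R))
        = ((a + b - x - w) * (x - w) - E * E) / ((x - w) * R)"
        using R xw by (simp add: field_simps)
      also have "(a + b - x - w) * (x - w) - E * E = R * R"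
        unfolding R(2) E2 by algebra
      finally show ?thesis using R(1) by simp
    qed
    ultimately show ?thesis by (simp add: R_def has_real_derivative_iff_has_vector_derivative)
  qed
  have "((\<lambda>x. arch a b x / (x - w)) has_integral A b - A a) {a..b}"
    by (rule fundamental_theorem_of_calculus_interior) (use ab in \<open>auto intro!: cA dA\<close>)
  moreover have "A b - A a = pi * ((a + b) / 2 - w + E)"
  proof -
    have "(2 * a - a - b) / (b - a) = -1" "(2 * b - a - b) / (b - a) = 1"
      using ab by (auto simp: field_simps)
    moreover have "arch a b a = 0" "arch a b b = 0" by (auto simp: arch_def)
    moreover have "u b = 1" using w ab by (auto simp: u_def)
    moreover have "u a = -1"
    proof -
      have "(b - a) * (w - a) = - ((b - a) * (a - w))" by algebra
      moreover have "(b - a) * (a - w) \<noteq> 0" using ab w by auto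
      ultimately show ?thesis unfolding u_def by (simp del: mult_eq_0_iff)
    qed
    ultimately show ?thesis by (simp add: A_def field_simps)
  qed
  ultimately show ?thesis by (simp add: E_def)
qed

lemma integrable_arch_over_diff:
  assumes "w \<notin> {a..b}"
  shows "integrable (lebesgue_on {a..b}) (\<lambda>x. arch a b x / (x - w))"
  by (rule continuous_imp_integrable_real)
     (use assms in \<open>auto intro!: continuous_intros continuous_on_arch\<close>)

lemma integral_arch_over_diff:
  assumes "a < b" "w \<notin> {a..b}"
  shows "(LINT x|lebesgue_on {a..b}. arch a b x / (x - w)) = pi * ((a + b) / 2 - w + outer_root a b w)"
  by (subst lebesgue_integral_eq_integral[OF integrable_arch_over_diff[OF assms(2)]])
     (use has_integral_arch_over_diff[OF assms] in \<open>auto dest: integral_unique\<close>)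

text \<open>The majorant is asked for only when \<open>e\<close> is between \<open>c\<close> and
  \<open>d\<close>, because \<open>pv_solution_exterior\<close> has one only below some unspecified
  \<open>e0\<close>.\<close>

lemma integral_dominated_convergence_at_right:
  fixes s :: "real \<Rightarrow> 'a \<Rightarrow> real"
  assumes "f \<in> borel_measurable M" "\<And>e. s e \<in> borel_measurable M" "integrable M w"
    and lim: "AE x in M. ((\<lambda>e. s e x) \<longlongrightarrow> f x) (at_right c)"
    and bound: "\<And>e. e \<in> {c<..<d} \<Longrightarrow> AE x in M. norm (s e x) \<le> w x" and "c < d"
  shows "((\<lambda>e. integral\<^sup>L M (s e)) \<longlongrightarrow> integral\<^sup>L M f) (at_right c)"
proof (rule tendsto_at_right_sequentially[OF \<open>c < d\<close>])
  fix S :: "nat \<Rightarrow> real" assume S: "\<And>n. c < S n" "\<And>n. S n < d" "S \<longlonglongrightarrow> c"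
  then have "\<forall>n. S n \<noteq> c" by (metis less_irrefl)
  with S have "filterlim S (at_right c) sequentially"
    by (simp add: filterlim_at)
  with lim have "AE x in M. (\<lambda>n. s (S n) x) \<longlonglongrightarrow> f x"
    by (auto elim!: eventually_mono intro: filterlim_compose)
  then show "(\<lambda>n. integral\<^sup>L M (s (S n))) \<longlonglongrightarrow> integral\<^sup>L M f"
    by (rule integral_dominated_convergence[OF assms(1-3)]) (use S bound in auto)
qed

lemma tendsto_integral_truncated:
  fixes f :: "real \<Rightarrow> real"
  assumes f: "integrable (lebesgue_on {a..b}) f"
  shows "((\<lambda>e. LINT x|lebesgue_on {a..b}. f x * (if \<bar>x - z\<bar> < e then 0 else 1)) \<longlongrightarrow> (LINT x|lebesgue_on {a..b}. f x))
           (at_right (0::real))"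
proof -
  have "AE x in lebesgue. x \<noteq> z"
    by (intro AE_completion AE_lborel_singleton)
  then have AE: "AE x in lebesgue_on {a..b}. x \<noteq> z"
    by (subst AE_restrict_space_iff) (simp, erule eventually_mono, simp)
  have fm: "f \<in> borel_measurable (lebesgue_on {a..b})" using f by simp
  show ?thesis
  proof (rule integral_dominated_convergence_at_right[where w = "\<lambda>x. norm (f x)" and d = 1])
    show "AE x in lebesgue_on {a..b}. ((\<lambda>e. f x * (if \<bar>x - z\<bar> < e then 0 else 1)) \<longlongrightarrow> f x) (at_right 0)"
      using AE
    proof eventually_elim
      case (elim x)
      have "\<forall>\<^sub>F e in at_right 0. f x * (if \<bar>x - z\<bar> < e then 0 else 1) = f x"
        by (rule eventually_mono[OF eventually_at_right_real[of 0 "\<bar>x - z\<bar>"]]) (use elim in auto)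
      then show ?case by (rule tendsto_eventually)
    qed
  qed (use f in \<open>auto intro!: borel_measurable_times[OF fm borel_measurable_lebesgue_on_borel]\<close>)
qed

text \<open>Partial fractions reduce \<open>arch a b x / (x - w)\<close> to the two explicit integrals.\<close>

lemma trunc_int_arch_over_diff:
  assumes "w \<notin> {a..b}" "z \<in> {a<..<b}" "e > 0"
  shows "trunc_int a b (\<lambda>x. arch a b x / (x - w)) z e =
    ((LINT x|lebesgue_on {a..b}. arch a b x / (x - w) * (if \<bar>x - z\<bar> < e then 0 else 1))
       - trunc_int a b (arch a b) z e) / (w - z)"
proof -
  have i: "integrable (lebesgue_on {a..b}) (\<lambda>x. arch a b x / (x - w) * (if \<bar>x - z\<bar> < e then 0 else 1))"
    using integrable_arch_over_diff[OF assms(1)]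
    by (rule integrable_mult_bounded_interval[where B = 1]) (auto intro!: borel_measurable_lebesgue_on_borel)
  have "trunc_int a b (\<lambda>x. arch a b x / (x - w)) z e =
     (LINT x|lebesgue_on {a..b}. (arch a b x / (x - w) * (if \<bar>x - z\<bar> < e then 0 else 1)
       - arch a b x * kern e (x - z)) / (w - z))"
    unfolding trunc_int_def
  proof (rule Bochner_Integration.integral_cong[OF refl])
    fix x assume "x \<in> space (lebesgue_on {a..b})"
    then have "x - w \<noteq> 0" "w - z \<noteq> 0" using assms by auto
    then show "arch a b x / (x - w) * kern e (x - z) = (arch a b x / (x - w) * (if \<bar>x - z\<bar> < e then 0 else 1)
       - arch a b x * kern e (x - z)) / (w - z)"
      using assms(3) by (auto simp: kern_def divide_simps) (auto simp: algebra_simps)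
  qed
  also have "\<dots> = ((LINT x|lebesgue_on {a..b}. arch a b x / (x - w) * (if \<bar>x - z\<bar> < e then 0 else 1))
       - trunc_int a b (arch a b) z e) / (w - z)"
    unfolding trunc_int_def
    using i integrable_times_kern[OF integrable_arch assms(3)] by simp
  finally show ?thesis .
qed

text \<open>The midpoint cancels between the two explicit integrals, leaving
  \<open>outer_root a b w - (w - z)\<close> to be divided by \<open>w - z\<close>.\<close>

lemma tendsto_trunc_int_arch_over_diff:
  assumes w: "w \<notin> {a..b}" and z: "z \<in> {a<..<b}"
  shows "(trunc_int a b (\<lambda>x. arch a b x / (x - w)) z \<longlongrightarrow> pi * (outer_root a b w / (w - z) - 1)) (at_right 0)"
proof -
  have ab: "a < b" and wz: "w - z \<noteq> 0" using assms by auto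
  have "((\<lambda>e. ((LINT x|lebesgue_on {a..b}. arch a b x / (x - w) * (if \<bar>x - z\<bar> < e then 0 else 1))
       - trunc_int a b (arch a b) z e) / (w - z)) \<longlongrightarrow>
      (pi * ((a + b) / 2 - w + outer_root a b w) - pi * ((a + b) / 2 - z)) / (w - z)) (at_right 0)"
    using tendsto_integral_truncated[OF integrable_arch_over_diff[OF w]] wz
    unfolding integral_arch_over_diff[OF ab w]
    by (intro tendsto_intros tendsto_trunc_int_arch[OF z])
  moreover have "\<forall>\<^sub>F e in at_right 0. trunc_int a b (\<lambda>x. arch a b x / (x - w)) z e =
    ((LINT x|lebesgue_on {a..b}. arch a b x / (x - w) * (if \<bar>x - z\<bar> < e then 0 else 1))
       - trunc_int a b (arch a b) z e) / (w - z)"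
    using eventually_at_right_less[of "0::real"]
    by eventually_elim (rule trunc_int_arch_over_diff[OF assms])
  moreover have "(pi * ((a + b) / 2 - w + outer_root a b w) - pi * ((a + b) / 2 - z)) / (w - z)
      = pi * (outer_root a b w / (w - z) - 1)"
    using wz by (simp add: field_simps)
  ultimately show ?thesis by (simp add: filterlim_cong)
qed

subsection \<open>A uniform bound for truncated Hilbert transforms\<close>

lemma integrable_pair_bounded:
  fixes F :: "'a \<Rightarrow> real" and G :: "'a \<times> 'b \<Rightarrow> real"
  assumes M: "sigma_finite_measure M" and N: "finite_measure N"
    and F: "integrable M F" and G: "G \<in> borel_measurable (M \<Otimes>\<^sub>M N)"
    and B: "\<And>p. p \<in> space (M \<Otimes>\<^sub>M N) \<Longrightarrow> \<bar>G p\<bar> \<le> B"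
  shows "integrable (M \<Otimes>\<^sub>M N) (\<lambda>(x, y). F x * G (x, y))"
proof -
  interpret M: sigma_finite_measure M by fact
  interpret N: finite_measure N by fact
  interpret pair_sigma_finite M N ..
  have Fm [measurable]: "F \<in> borel_measurable M" using F by simp
  note G [measurable]
  have "integrable (M \<Otimes>\<^sub>M N) (\<lambda>(x, y). \<bar>B\<bar> * F x)"
    by (rule Fubini_integrable) (use F in auto)
  then show ?thesis
  proof (rule Bochner_Integration.integrable_bound)
    show "AE p in M \<Otimes>\<^sub>M N. norm (case p of (x, y) \<Rightarrow> F x * G (x, y)) \<le> norm (case p of (x, y) \<Rightarrow> \<bar>B\<bar> * F x)"
    proof (rule AE_I2)
      fix p assume p: "p \<in> space (M \<Otimes>\<^sub>M N)"
      have "\<bar>G p\<bar> \<le> \<bar>B\<bar>" using B[OF p] by simp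
      then show "norm (case p of (x, y) \<Rightarrow> F x * G (x, y)) \<le> norm (case p of (x, y) \<Rightarrow> \<bar>B\<bar> * F x)"
        by (cases p) (simp add: abs_mult mult.commute[of "\<bar>F _\<bar>"] mult_right_mono)
    qed
  qed measurable
qed

lemma integrable_pair_mult:
  fixes f g :: "_ \<Rightarrow> real"
  assumes M: "sigma_finite_measure M" and N: "sigma_finite_measure N"
    and f: "integrable M f" and g: "integrable N g"
  shows "integrable (M \<Otimes>\<^sub>M N) (\<lambda>(x, y). f x * g y)"
proof -
  interpret M: sigma_finite_measure M by fact
  interpret N: sigma_finite_measure N by fact
  interpret pair_sigma_finite M N ..
  have [measurable]: "f \<in> borel_measurable M" "g \<in> borel_measurable N" using f g by auto
  show ?thesis
    by (rule Fubini_integrable) (use f g in \<open>auto simp: abs_mult\<close>)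
qed

text \<open>Expand the square as a double integral over \<open>u\<close> and \<open>v\<close>, then
  integrate over \<open>x\<close> first: the squared L2 norm of an integral transform becomes a
  quadratic form in \<open>f\<close>, with the correlation of \<open>g\<close> as kernel.
  Boundedness of \<open>g\<close> justifies Fubini.\<close>

lemma integral_kernel_square:
  fixes f :: "'a \<Rightarrow> real" and g :: "'a \<Rightarrow> 'b \<Rightarrow> real"
  assumes M: "finite_measure M" and N: "finite_measure N"
    and f: "integrable M f" and g [measurable]: "(\<lambda>(u, x). g u x) \<in> borel_measurable (M \<Otimes>\<^sub>M N)"
    and B: "\<And>u x. u \<in> space M \<Longrightarrow> x \<in> space N \<Longrightarrow> \<bar>g u x\<bar> \<le> B"
  shows "integrable N (\<lambda>x. (LINT u|M. f u * g u x)\<^sup>2)" (is ?A)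
    and "(LINT x|N. (LINT u|M. f u * g u x)\<^sup>2)
      = (LINT p|(M \<Otimes>\<^sub>M M). f (fst p) * f (snd p) * (LINT x|N. g (fst p) x * g (snd p) x))" (is ?B)
    and "integrable (M \<Otimes>\<^sub>M M) (\<lambda>p. f (fst p) * f (snd p) * (LINT x|N. g (fst p) x * g (snd p) x))" (is ?C)
proof -
  interpret M: finite_measure M by fact
  interpret N: finite_measure N by fact
  interpret MM: pair_sigma_finite M M ..
  interpret NM: pair_sigma_finite N M ..
  interpret PN: pair_sigma_finite "M \<Otimes>\<^sub>M M" N ..
  have [measurable]: "f \<in> borel_measurable M" using f by simp
  define F where "F = (\<lambda>p. f (fst p) * f (snd p))"
  define G where "G = (\<lambda>p x. g (fst p) x * g (snd p) x)"
  have iF: "integrable (M \<Otimes>\<^sub>M M) F"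
    using integrable_pair_mult[OF M.sigma_finite_measure_axioms M.sigma_finite_measure_axioms f f]
    by (simp add: F_def case_prod_unfold)
  have Gm: "(\<lambda>q. G (fst q) (snd q)) \<in> borel_measurable ((M \<Otimes>\<^sub>M M) \<Otimes>\<^sub>M N)"
    unfolding G_def by measurable
  have GB: "\<bar>G (fst q) (snd q)\<bar> \<le> B * B" if "q \<in> space ((M \<Otimes>\<^sub>M M) \<Otimes>\<^sub>M N)" for q
  proof -
    have 1: "\<bar>g (fst (fst q)) (snd q)\<bar> \<le> B" "\<bar>g (snd (fst q)) (snd q)\<bar> \<le> B"
      using that by (auto intro!: B simp: space_pair_measure)
    show ?thesis unfolding G_def abs_mult
      by (rule mult_mono) (use 1 in auto)
  qed
  have int: "integrable ((M \<Otimes>\<^sub>M M) \<Otimes>\<^sub>M N) (\<lambda>(p, x). F p * G p x)"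
    using integrable_pair_bounded[OF _ N iF Gm GB] by (simp add: MM.P.sigma_finite_measure_axioms)
  have sq: "(LINT u|M. f u * g u x)\<^sup>2 = (LINT p|(M \<Otimes>\<^sub>M M). F p * G p x)" if x: "x \<in> space N" for x
  proof -
    have [measurable]: "(\<lambda>u. g u x) \<in> borel_measurable M" using x by measurable
    have ig: "integrable M (\<lambda>u. f u * g u x)"
    proof (rule Bochner_Integration.integrable_bound)
      show "integrable M (\<lambda>u. B * f u)" using f by simp
      show "AE u in M. norm (f u * g u x) \<le> norm (B * f u)"
      proof (rule AE_I2)
        fix u assume "u \<in> space M"
        then have "\<bar>g u x\<bar> \<le> \<bar>B\<bar>" using B[OF _ x, of u] by simp
        then show "norm (f u * g u x) \<le> norm (B * f u)"
          by (simp add: abs_mult mult.commute[of "\<bar>f _\<bar>"] mult_right_mono)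
      qed
    qed measurable
    have "(LINT p|(M \<Otimes>\<^sub>M M). F p * G p x) = (LINT p|(M \<Otimes>\<^sub>M M). (case p of (u, v) \<Rightarrow> (f u * g u x) * (f v * g v x)))"
      by (simp add: F_def G_def case_prod_unfold mult_ac)
    also have "\<dots> = (LINT u|M. LINT v|M. (f u * g u x) * (f v * g v x))"
      using MM.integral_fst'[OF integrable_pair_mult[OF M.sigma_finite_measure_axioms M.sigma_finite_measure_axioms ig ig]]
      by simp
    finally show ?thesis by (simp add: power2_eq_square)
  qed
  have "integrable N (\<lambda>x. LINT p|(M \<Otimes>\<^sub>M M). F p * G p x)"
    using PN.integrable_snd[OF int] .
  then show ?A
    by (rule Bochner_Integration.integrable_cong[THEN iffD1, rotated -1]) (auto simp: sq)
  have "(LINT x|N. (LINT u|M. f u * g u x)\<^sup>2) = (LINT x|N. LINT p|(M \<Otimes>\<^sub>M M). F p * G p x)"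
    by (rule Bochner_Integration.integral_cong) (auto simp: sq)
  also have "\<dots> = (LINT p|(M \<Otimes>\<^sub>M M). LINT x|N. F p * G p x)"
    by (rule PN.Fubini_integral[OF int])
  finally show ?B by (simp add: F_def G_def)
  show ?C using PN.integrable_fst[OF int] by (simp add: F_def G_def)
qed

text \<open>Schur's test for a symmetric majorant \<open>K\<close>: bound
  \<open>\<bar>f u * f v\<bar>\<close> by half the sum of the squares. By symmetry both halves have
  the same integral, and each is controlled by the row integrals of \<open>K\<close>.\<close>

lemma integral_kernel_Schur:
  fixes f :: "'a \<Rightarrow> real" and K :: "'a \<Rightarrow> 'a \<Rightarrow> real"
  assumes M: "finite_measure M" and f: "integrable M f" "integrable M (\<lambda>x. (f x)\<^sup>2)"
    and K [measurable]: "(\<lambda>(u, v). K u v) \<in> borel_measurable (M \<Otimes>\<^sub>M M)"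
    and B: "\<And>u v. u \<in> space M \<Longrightarrow> v \<in> space M \<Longrightarrow> 0 \<le> K u v \<and> K u v \<le> B"
    and sym: "\<And>u v. K u v = K v u"
    and C: "\<And>u. u \<in> space M \<Longrightarrow> (LINT v|M. K u v) \<le> C"
    and L: "integrable (M \<Otimes>\<^sub>M M) (\<lambda>p. f (fst p) * f (snd p) * L p)" 
      "\<And>u v. u \<in> space M \<Longrightarrow> v \<in> space M \<Longrightarrow> \<bar>L (u, v)\<bar> \<le> K u v"
  shows "(LINT p|(M \<Otimes>\<^sub>M M). f (fst p) * f (snd p) * L p) \<le> C * (LINT x|M. (f x)\<^sup>2)"
proof -
  interpret M: finite_measure M by fact
  interpret MM: pair_sigma_finite M M ..
  have [measurable]: "f \<in> borel_measurable M" using f by simp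
  have i1: "integrable (M \<Otimes>\<^sub>M M) (\<lambda>(u, v). (f u)\<^sup>2 * K u v)"
    using integrable_pair_bounded[OF M.sigma_finite_measure_axioms M f(2) K, of B] B
    by (auto simp: space_pair_measure)
  have i2: "integrable (M \<Otimes>\<^sub>M M) (\<lambda>(u, v). (f v)\<^sup>2 * K u v)"
    using MM.integrable_product_swap[OF i1] by (simp add: case_prod_unfold sym)
  have "(LINT p|(M \<Otimes>\<^sub>M M). f (fst p) * f (snd p) * L p) \<le>
     (LINT p|(M \<Otimes>\<^sub>M M). ((case p of (u, v) \<Rightarrow> (f u)\<^sup>2 * K u v) + (case p of (u, v) \<Rightarrow> (f v)\<^sup>2 * K u v)) / 2)"
  proof (rule integral_mono[OF L(1)])
    fix p assume "p \<in> space (M \<Otimes>\<^sub>M M)"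
    then obtain u v where p: "p = (u, v)" "u \<in> space M" "v \<in> space M" by (auto simp: space_pair_measure)
    have "f u * f v * L (u, v) \<le> \<bar>f u * f v\<bar> * K u v"
      using order_trans[OF abs_ge_self[of "f u * f v * L (u, v)"]] mult_left_mono[OF L(2)[OF p(2,3)], of "\<bar>f u * f v\<bar>"]
      by (simp add: abs_mult)
    also have "\<dots> \<le> ((f u)\<^sup>2 + (f v)\<^sup>2) / 2 * K u v"
    proof (rule mult_right_mono)
      show "\<bar>f u * f v\<bar> \<le> ((f u)\<^sup>2 + (f v)\<^sup>2) / 2"
        using sum_squares_bound[of "\<bar>f u\<bar>" "\<bar>f v\<bar>"] by (simp add: abs_mult)
    qed (use B[OF p(2,3)] in auto)
    finally show "f (fst p) * f (snd p) * L p \<le>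
      ((case p of (u, v) \<Rightarrow> (f u)\<^sup>2 * K u v) + (case p of (u, v) \<Rightarrow> (f v)\<^sup>2 * K u v)) / 2"
      by (simp add: p field_simps)
  qed (use i1 i2 in auto)
  also have "\<dots> = ((LINT p|(M \<Otimes>\<^sub>M M). (case p of (u, v) \<Rightarrow> (f u)\<^sup>2 * K u v)) + (LINT p|(M \<Otimes>\<^sub>M M). (case p of (u, v) \<Rightarrow> (f v)\<^sup>2 * K u v))) / 2"
    using i1 i2 by simp
  also have "(LINT p|(M \<Otimes>\<^sub>M M). (case p of (u, v) \<Rightarrow> (f v)\<^sup>2 * K u v)) = (LINT p|(M \<Otimes>\<^sub>M M). (case p of (u, v) \<Rightarrow> (f u)\<^sup>2 * K u v))"
    using MM.integral_product_swap[of "\<lambda>(u, v). (f u)\<^sup>2 * K u v"] i1 by (simp add: case_prod_unfold sym)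
  also have "(LINT p|(M \<Otimes>\<^sub>M M). (case p of (u, v) \<Rightarrow> (f u)\<^sup>2 * K u v)) = (LINT u|M. LINT v|M. (f u)\<^sup>2 * K u v)"
    using MM.integral_fst'[OF i1] by simp
  also have "\<dots> \<le> (LINT u|M. (f u)\<^sup>2 * C)"
  proof (rule integral_mono)
    show "integrable M (\<lambda>u. LINT v|M. (f u)\<^sup>2 * K u v)"
      using MM.integrable_fst'[OF i1] by simp
  qed (use f C in \<open>auto intro!: mult_left_mono\<close>)
  finally show ?thesis by (simp add: mult.commute)
qed

text \<open>Intended for the boundary terms of \<open>integral_cauchy_kernels\<close>, where the
  margin around \<open>{a..b}\<close> makes the arguments of the logarithms at least 1.\<close>

lemma abs_ln_diff_le:
  assumes "p \<ge> 1" "q \<ge> (1::real)"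
  shows "\<bar>ln p - ln q\<bar> \<le> \<bar>p - q\<bar>"
proof -
  have *: "ln p - ln q \<le> p - q" if "1 \<le> q" "q \<le> p" for p q :: real
  proof -
    have "ln p - ln q = ln (p / q)" using that by (simp add: ln_div)
    also have "\<dots> \<le> p / q - 1" using that by (intro ln_le_minus_one) auto
    also have "\<dots> = (p - q) / q" using that by (simp add: field_simps)
    also have "\<dots> \<le> p - q" using that divide_left_mono[of 1 q "p - q"] by simp
    finally show ?thesis .
  qed
  have "ln p \<le> ln q \<longleftrightarrow> p \<le> q" using assms by simp
  then show ?thesis using *[of q p] *[of p q] assms by (cases "q \<le> p") (auto simp: abs_if)
qed

lemma abs_arctan_le: "\<bar>arctan x\<bar> \<le> pi / 2"
  using arctan_lbound[of x] arctan_ubound[of x] by linarith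

lemma square_plus_square_nonzero:
  assumes "e > 0"
  shows "(u - x)\<^sup>2 + e\<^sup>2 \<noteq> (0::real)"
  using assms by (simp add: sum_power2_eq_zero_iff)

text \<open>The integrand is the real part of \<open>1 / ((u - x - i e) (v - x + i e))\<close>; over the whole line the
  integral would be exactly \<open>4 pi e / ((u - v)\<^sup>2 + 4 e\<^sup>2)\<close>. The margin 1 on both sides of \<open>{a..b}\<close>
  makes the boundary terms bounded.\<close>

lemma integral_cauchy_kernels:
  fixes a b e u v :: real
  assumes e: "e > 0" and u: "u \<in> {a..b}" and v: "v \<in> {a..b}"
  shows "\<bar>LINT x|lebesgue_on {a - 1..b + 1}. ((u - x) * (v - x) + e\<^sup>2) / (((u - x)\<^sup>2 + e\<^sup>2) * ((v - x)\<^sup>2 + e\<^sup>2))\<bar>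
    \<le> 4 * pi * e / ((u - v)\<^sup>2 + 4 * e\<^sup>2) + 2 * (b - a + 1)"
proof -
  let ?g = "\<lambda>x. ((u - x) * (v - x) + e\<^sup>2) / (((u - x)\<^sup>2 + e\<^sup>2) * ((v - x)\<^sup>2 + e\<^sup>2))"
  define d where "d = v - u"
  \<comment> \<open>Partial fractions: as a function of \<open>x\<close>,
    \<open>1 / ((u - x - i e) (v - x + i e))\<close> has the poles \<open>u - i e\<close> and
    \<open>v + i e\<close>, and \<open>D\<close> is the squared modulus of their difference.
    \<open>P\<close> and \<open>Q\<close> collect the logarithms and the arctangents.\<close>
  define D where "D = d\<^sup>2 + 4 * e\<^sup>2"
  have D: "D > 0" using e by (auto simp: D_def intro!: add_nonneg_pos)
  define P where "P = (\<lambda>x. d / 2 * (ln ((v - x)\<^sup>2 + e\<^sup>2) - ln ((u - x)\<^sup>2 + e\<^sup>2)))"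
  define Q where "Q = (\<lambda>x. 2 * e * (arctan ((x - u) / e) + arctan ((x - v) / e)))"
  have deriv: "((\<lambda>x. (P x + Q x) / D) has_real_derivative ?g x) (at x)" for x
  proof -
    define U V where "U = (u - x)\<^sup>2 + e\<^sup>2" and "V = (v - x)\<^sup>2 + e\<^sup>2"
    have UV: "U > 0" "V > 0" using e by (auto simp: U_def V_def intro!: add_nonneg_pos)
    have at: "((\<lambda>x. arctan ((x - w) / e)) has_real_derivative e / ((w - x)\<^sup>2 + e\<^sup>2)) (at x)" for w
    proof -
      have "((\<lambda>x. (x - w) / e) has_real_derivative 1 / e) (at x)"
        by (rule DERIV_cdivide) (auto intro!: derivative_eq_intros)
      from DERIV_chain2[OF DERIV_arctan this]
      have "((\<lambda>x. arctan ((x - w) / e)) has_real_derivative inverse (1 + ((x - w) / e)\<^sup>2) * (1 / e)) (at x)" .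
      moreover have "1 + ((x - w) / e)\<^sup>2 = ((w - x)\<^sup>2 + e\<^sup>2) / e\<^sup>2"
        using e by (simp add: power_divide add_divide_distrib power2_commute[of x w])
      ultimately show ?thesis using e by (simp add: power2_eq_square)
    qed
    have ld: "((\<lambda>x. ln ((w - x)\<^sup>2 + e\<^sup>2)) has_real_derivative 2 * (x - w) / ((w - x)\<^sup>2 + e\<^sup>2)) (at x)" for w
    proof -
      have "((\<lambda>x. (w - x)\<^sup>2 + e\<^sup>2) has_real_derivative 2 * (x - w)) (at x)"
        by (auto intro!: derivative_eq_intros)
      moreover have "(w - x)\<^sup>2 + e\<^sup>2 > 0" using e by (auto intro!: add_nonneg_pos)
      ultimately show ?thesis using DERIV_chain2[OF DERIV_ln_divide] by fastforce
    qed
    have "((\<lambda>x. (P x + Q x) / D) has_real_derivative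
        (d / 2 * (2 * (x - v) / V - 2 * (x - u) / U) + 2 * e * (e / U + e / V)) / D) (at x)"
      unfolding P_def Q_def U_def V_def
      by (intro DERIV_cdivide DERIV_add DERIV_cmult DERIV_diff ld at)
    moreover have "(d / 2 * (2 * (x - v) / V - 2 * (x - u) / U) + 2 * e * (e / U + e / V)) / D = ?g x"
    proof -
      have "d / 2 * (2 * (x - v) / V - 2 * (x - u) / U) + 2 * e * (e / U + e / V)
        = (d * ((x - v) * U - (x - u) * V) + 2 * e\<^sup>2 * (U + V)) / (U * V)"
        using UV by (simp add: divide_simps power2_eq_square) (simp add: algebra_simps)
      also have "d * ((x - v) * U - (x - u) * V) + 2 * e\<^sup>2 * (U + V) = ((u - x) * (v - x) + e\<^sup>2) * D"
        unfolding U_def V_def D_def d_def by algebra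
      finally show ?thesis using D by (simp add: U_def V_def)
    qed
    ultimately show ?thesis by simp
  qed
  have "(?g has_integral ((P (b + 1) + Q (b + 1)) / D - (P (a - 1) + Q (a - 1)) / D)) {a - 1..b + 1}"
    by (rule fundamental_theorem_of_calculus)
       (use u deriv in \<open>auto simp: has_real_derivative_iff_has_vector_derivative[symmetric] intro: has_field_derivative_at_within\<close>)
  moreover have "integrable (lebesgue_on {a - 1..b + 1}) ?g"
    using square_plus_square_nonzero[OF e]
    by (intro continuous_imp_integrable_real continuous_intros) auto
  ultimately have eq: "(LINT x|lebesgue_on {a - 1..b + 1}. ?g x) = (P (b + 1) + Q (b + 1)) / D - (P (a - 1) + Q (a - 1)) / D"
    by (subst lebesgue_integral_eq_integral) (auto dest: integral_unique)
  \<comment> \<open>The difference of the logarithms supplies a second factor \<open>d\<close>, and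
    \<open>d\<^sup>2 \<le> D\<close> absorbs both, so nothing blows up as \<open>e\<close> and
    \<open>u - v\<close> become small.\<close>
  have P: "\<bar>P x\<bar> / D \<le> b - a + 1" if x: "x = b + 1 \<or> x = a - 1" for x
  proof -
    have w: "(w - x)\<^sup>2 + e\<^sup>2 \<ge> 1" if "w \<in> {a..b}" for w
    proof -
      have "\<bar>w - x\<bar> \<ge> 1" using x that by auto
      then have "(w - x)\<^sup>2 \<ge> 1" using power_mono[of 1 "\<bar>w - x\<bar>" 2] by simp
      then show ?thesis by (simp add: add_increasing2)
    qed
    have "\<bar>P x\<bar> = \<bar>d\<bar> / 2 * \<bar>ln ((v - x)\<^sup>2 + e\<^sup>2) - ln ((u - x)\<^sup>2 + e\<^sup>2)\<bar>"
      by (simp add: P_def abs_mult)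
    also have "\<dots> \<le> \<bar>d\<bar> / 2 * \<bar>((v - x)\<^sup>2 + e\<^sup>2) - ((u - x)\<^sup>2 + e\<^sup>2)\<bar>"
      by (intro mult_left_mono abs_ln_diff_le w u v) auto
    also have "((v - x)\<^sup>2 + e\<^sup>2) - ((u - x)\<^sup>2 + e\<^sup>2) = d * (u + v - 2 * x)"
      unfolding d_def by algebra
    also have "\<bar>d\<bar> / 2 * \<bar>d * (u + v - 2 * x)\<bar> = d\<^sup>2 * (\<bar>u + v - 2 * x\<bar> / 2)"
      by (simp add: abs_mult power2_eq_square)
    also have "\<dots> \<le> d\<^sup>2 * (b - a + 1)"
      by (rule mult_left_mono) (use x u v in auto)
    also have "\<dots> \<le> D * (b - a + 1)"
      by (rule mult_right_mono) (use u in \<open>auto simp: D_def\<close>)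
    finally show ?thesis using D by (simp add: divide_le_eq mult.commute)
  qed
  \<comment> \<open>The two endpoints together give the main term
    \<open>4 * pi * e / D\<close>.\<close>
  have Q: "\<bar>Q x\<bar> / D \<le> 2 * pi * e / D" for x
  proof -
    have "\<bar>Q x\<bar> = 2 * e * \<bar>arctan ((x - u) / e) + arctan ((x - v) / e)\<bar>"
      using e by (simp add: Q_def abs_mult)
    also have "\<dots> \<le> 2 * e * (pi / 2 + pi / 2)"
      by (intro mult_left_mono order_trans[OF abs_triangle_ineq] add_mono abs_arctan_le) (use e in auto)
    finally show ?thesis using D by (intro divide_right_mono) (auto simp: mult_ac)
  qed
  have "\<bar>(P (b + 1) + Q (b + 1)) / D - (P (a - 1) + Q (a - 1)) / D\<bar>
    \<le> \<bar>P (b + 1)\<bar> / D + \<bar>Q (b + 1)\<bar> / D + (\<bar>P (a - 1)\<bar> / D + \<bar>Q (a - 1)\<bar> / D)"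
    using D by (simp add: diff_divide_distrib[symmetric] add_divide_distrib[symmetric] divide_right_mono)
  also have "\<dots> \<le> (b - a + 1) + 2 * pi * e / D + ((b - a + 1) + 2 * pi * e / D)"
    by (intro add_mono P Q) auto
  finally show ?thesis unfolding eq
    by (simp add: D_def d_def power2_commute[of v u])
qed

section \<open>Real square-integrable functions on an interval\<close>

definition sq_integrable :: "real \<Rightarrow> real \<Rightarrow> (real \<Rightarrow> real) \<Rightarrow> bool" where
  "sq_integrable a b f \<longleftrightarrow> f \<in> borel_measurable (lebesgue_on {a..b}) \<and>
     integrable (lebesgue_on {a..b}) (\<lambda>x. (f x)\<^sup>2)"

lemma sq_integrable_mult:
  assumes "sq_integrable a b f" "sq_integrable a b g"
  shows "integrable (lebesgue_on {a..b}) (\<lambda>x. f x * g x)"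
proof (rule Bochner_Integration.integrable_bound)
  show "integrable (lebesgue_on {a..b}) (\<lambda>x. (f x)\<^sup>2 + (g x)\<^sup>2)"
    and "(\<lambda>x. f x * g x) \<in> borel_measurable (lebesgue_on {a..b})"
    using assms by (auto simp: sq_integrable_def)
  have "\<bar>f x * g x\<bar> \<le> (f x)\<^sup>2 + (g x)\<^sup>2" for x
    using sum_squares_bound[of "\<bar>f x\<bar>" "\<bar>g x\<bar>"] abs_ge_zero[of "f x * g x"] unfolding abs_mult power2_abs by linarith
  then show "AE x in lebesgue_on {a..b}. norm (f x * g x) \<le> norm ((f x)\<^sup>2 + (g x)\<^sup>2)"
    by simp
qed

lemma sq_integrable_bounded:
  assumes "f \<in> borel_measurable (lebesgue_on {a..b})" "\<And>x. x \<in> {a..b} \<Longrightarrow> \<bar>f x\<bar> \<le> B"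
  shows "sq_integrable a b f"
proof -
  have "\<bar>(f x)\<^sup>2\<bar> \<le> B\<^sup>2" if "x \<in> {a..b}" for x
    using power_mono[OF assms(2)[OF that], of 2] by simp
  then show ?thesis
    unfolding sq_integrable_def using assms(1) by (auto intro!: integrable_bounded_interval[where B = "B\<^sup>2"])
qed

lemma sq_integrable_const: "sq_integrable a b (\<lambda>_. c)"
  by (rule sq_integrable_bounded) auto

lemma sq_integrable_imp_integrable: "sq_integrable a b f \<Longrightarrow> integrable (lebesgue_on {a..b}) f"
  using sq_integrable_mult[OF _ sq_integrable_const[of a b 1]] by simp

lemma sq_integrable_cmult: "sq_integrable a b f \<Longrightarrow> sq_integrable a b (\<lambda>x. c * f x)"
  by (auto simp: sq_integrable_def power_mult_distrib)

lemma sq_integrable_add: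
  assumes "sq_integrable a b f" "sq_integrable a b g"
  shows "sq_integrable a b (\<lambda>x. f x + g x)"
  using assms sq_integrable_mult[OF assms] by (auto simp: sq_integrable_def power2_sum mult.assoc)

lemma sq_integrable_diff:
  assumes "sq_integrable a b f" "sq_integrable a b g"
  shows "sq_integrable a b (\<lambda>x. f x - g x)"
  using sq_integrable_add[OF assms(1) sq_integrable_cmult[OF assms(2), of "-1"]] by simp

lemma sq_integrable_sum:
  "finite I \<Longrightarrow> (\<And>i. i \<in> I \<Longrightarrow> sq_integrable a b (f i)) \<Longrightarrow> sq_integrable a b (\<lambda>x. \<Sum>i\<in>I. f i x)"
  by (induction I rule: finite_induct) (auto intro: sq_integrable_const sq_integrable_add)

text \<open>The product of two Lebesgue sigma-algebras contains the Borel sets of the plane, since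
  both coordinates are measurable into \<open>borel\<close>. All kernels below are Borel functions
  of the pair.\<close>

lemma borel_measurable_pair_lebesgue_on:
  fixes h :: "real \<times> real \<Rightarrow> real"
  assumes "h \<in> borel_measurable (borel \<Otimes>\<^sub>M borel)"
  shows "h \<in> borel_measurable (lebesgue_on A \<Otimes>\<^sub>M lebesgue_on B)"
proof -
  have id: "(\<lambda>x. x) \<in> borel_measurable (lebesgue_on S)" for S :: "real set"
    by (rule borel_measurable_lebesgue_on_borel) simp
  have "(\<lambda>p. (fst p, snd p)) \<in> (lebesgue_on A \<Otimes>\<^sub>M lebesgue_on B) \<rightarrow>\<^sub>M (borel \<Otimes>\<^sub>M borel)"
    by (intro measurable_Pair measurable_compose[OF measurable_fst id] measurable_compose[OF measurable_snd id])
  from measurable_compose[OF this assms] show ?thesis by simp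
qed

section \<open>Comparison with the Poisson kernels and the uniform L2 bound\<close>

definition conj_poisson :: "real \<Rightarrow> real \<Rightarrow> real" where
  "conj_poisson e y = y / (y\<^sup>2 + e\<^sup>2)"

text \<open>\<open>conj_poisson e y\<close> and \<open>poisson e y\<close> are the real and
  imaginary parts of \<open>1 / (y - i e)\<close>, without the usual factor
  \<open>1 / pi\<close>.\<close>

definition poisson :: "real \<Rightarrow> real \<Rightarrow> real" where
  "poisson e y = e / (y\<^sup>2 + e\<^sup>2)"

lemma borel_measurable_poisson [measurable]:
  "conj_poisson e \<in> borel_measurable borel" "poisson e \<in> borel_measurable borel"
  unfolding conj_poisson_def poisson_def by measurable

lemma poisson_bounds:
  assumes "e > 0"
  shows "\<bar>conj_poisson e y\<bar> \<le> 1 / e" "0 \<le> poisson e y" "poisson e y \<le> 1 / e"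
proof -
  have D: "y\<^sup>2 + e\<^sup>2 > 0" using assms by (auto intro!: add_nonneg_pos)
  show "0 \<le> poisson e y" using assms by (simp add: poisson_def)
  show "poisson e y \<le> 1 / e" using assms D by (simp add: poisson_def divide_simps power2_eq_square)
  have "2 * \<bar>y\<bar> * e \<le> y\<^sup>2 + e\<^sup>2" using sum_squares_bound[of "\<bar>y\<bar>" e] by simp
  moreover have "\<bar>y\<bar> * e \<ge> 0" using assms by simp
  ultimately have "\<bar>y\<bar> * e \<le> y\<^sup>2 + e\<^sup>2" by linarith
  then show "\<bar>conj_poisson e y\<bar> \<le> 1 / e"
    using assms D by (simp add: conj_poisson_def divide_simps)
qed

text \<open>For \<open>\<bar>y\<bar> < e\<close> the numerator of \<open>conj_poisson\<close> is
  below \<open>e\<close>. Otherwise the difference is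
  \<open>e * (e / y) / (y\<^sup>2 + e\<^sup>2)\<close> with
  \<open>e / \<bar>y\<bar> \<le> 1\<close>.\<close>

lemma kern_approx:
  assumes "e > 0"
  shows "\<bar>kern e y - conj_poisson e y\<bar> \<le> poisson e y"
proof -
  have D: "y\<^sup>2 + e\<^sup>2 > 0" using assms by (auto intro!: add_nonneg_pos)
  show "\<bar>kern e y - conj_poisson e y\<bar> \<le> poisson e y"
  proof (cases "\<bar>y\<bar> < e")
    case True
    then show ?thesis using D by (simp add: kern_def conj_poisson_def poisson_def divide_right_mono)
  next
    case False
    then have y: "y \<noteq> 0" "\<bar>y\<bar> \<ge> e" using assms by auto
    have "kern e y - conj_poisson e y = e * (e / y) / (y\<^sup>2 + e\<^sup>2)"
      using y D False by (simp add: kern_def conj_poisson_def divide_simps power2_eq_square)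
    also have "\<bar>\<dots>\<bar> = e * (e / \<bar>y\<bar>) / (y\<^sup>2 + e\<^sup>2)"
      using D assms by (simp add: abs_mult)
    also have "\<dots> \<le> e * 1 / (y\<^sup>2 + e\<^sup>2)"
      using y assms D by (intro divide_right_mono mult_left_mono) auto
    finally show ?thesis by (simp add: poisson_def)
  qed
qed

lemma integrable_times_bounded_borel:
  fixes f g :: "real \<Rightarrow> real"
  assumes "integrable (lebesgue_on {a..b}) f" "g \<in> borel_measurable borel" "\<And>x. \<bar>g x\<bar> \<le> B"
  shows "integrable (lebesgue_on {a..b}) (\<lambda>x. f x * g x)"
  by (rule integrable_mult_bounded_interval[OF assms(1) borel_measurable_lebesgue_on_borel[OF assms(2)] assms(3)])

text \<open>The arctangent increases by at most \<open>pi\<close> over any interval, whatever its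
  scale, so the row integral needed for Schur's test has a bound free of \<open>e\<close>.\<close>

lemma integral_poisson_le:
  assumes "e > 0" "a \<le> b"
  shows "(LINT v|lebesgue_on {a..b}. 4 * pi * e / ((u - v)\<^sup>2 + 4 * e\<^sup>2) + 2 * (b - a + 1))
     \<le> 2 * pi\<^sup>2 + 2 * (b - a + 1) * (b - a)"
proof -
  have nz: "(u - v)\<^sup>2 + 4 * e\<^sup>2 > 0" for v using assms by (auto intro!: add_nonneg_pos)
  let ?g = "\<lambda>v. 4 * pi * e / ((u - v)\<^sup>2 + 4 * e\<^sup>2) + 2 * (b - a + 1)"
  define A where "A = (\<lambda>v. 2 * pi * arctan ((v - u) / (2 * e)) + 2 * (b - a + 1) * v)"
  have "(A has_real_derivative ?g v) (at v)" for v
  proof -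
    have "((\<lambda>v. (v - u) / (2 * e)) has_real_derivative 1 / (2 * e)) (at v)"
      by (rule DERIV_cdivide) (auto intro!: derivative_eq_intros)
    from DERIV_chain2[OF DERIV_arctan this]
    have "((\<lambda>v. arctan ((v - u) / (2 * e))) has_real_derivative inverse (1 + ((v - u) / (2 * e))\<^sup>2) * (1 / (2 * e))) (at v)" .
    moreover have "1 + ((v - u) / (2 * e))\<^sup>2 = ((u - v)\<^sup>2 + 4 * e\<^sup>2) / (4 * e\<^sup>2)"
      using assms by (simp add: power_divide add_divide_distrib power2_commute[of v u] power_mult_distrib)
    moreover have "inverse (((u - v)\<^sup>2 + 4 * e\<^sup>2) / (4 * e\<^sup>2)) * (1 / (2 * e)) = 2 * e / ((u - v)\<^sup>2 + 4 * e\<^sup>2)"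
    proof -
      have "inverse (D / (4 * e\<^sup>2)) * (1 / (2 * e)) = 2 * e / D" if "D > 0" for D
        using that assms by (simp add: divide_simps power2_eq_square)
      then show ?thesis using nz .
    qed
    ultimately have "((\<lambda>v. arctan ((v - u) / (2 * e))) has_real_derivative 2 * e / ((u - v)\<^sup>2 + 4 * e\<^sup>2)) (at v)"
      by simp
    from DERIV_add[OF DERIV_cmult[OF this, of "2 * pi"] DERIV_cmult[OF DERIV_ident, of "2 * (b - a + 1)"]]
    show ?thesis by (simp add: A_def mult.assoc)
  qed
  then have "(?g has_integral (A b - A a)) {a..b}"
    by (intro fundamental_theorem_of_calculus assms)
       (auto simp: has_real_derivative_iff_has_vector_derivative[symmetric] intro: has_field_derivative_at_within)
  moreover have "integrable (lebesgue_on {a..b}) ?g"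
    using nz by (intro continuous_imp_integrable_real continuous_intros) (auto simp: less_imp_neq[symmetric])
  ultimately have "(LINT v|lebesgue_on {a..b}. ?g v) = A b - A a"
    by (subst lebesgue_integral_eq_integral) (auto dest: integral_unique)
  also have "\<dots> = 2 * pi * (arctan ((b - u) / (2 * e)) - arctan ((a - u) / (2 * e))) + 2 * (b - a + 1) * (b - a)"
    by (simp add: A_def algebra_simps)
  also have "\<dots> \<le> 2 * pi * pi + 2 * (b - a + 1) * (b - a)"
    using abs_arctan_le[of "(b - u) / (2 * e)"] abs_arctan_le[of "(a - u) / (2 * e)"]
    by (intro add_right_mono mult_left_mono) auto
  finally show ?thesis by (simp add: power2_eq_square)
qed

text \<open>The two squares are estimated together because their correlations add up to the real
  part of \<open>1 / ((u - x - i e) (v - x + i e))\<close>, whose integral is explicit. The outer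
  integration runs over the enlarged interval for the sake of
  \<open>integral_cauchy_kernels\<close>.\<close>

lemma integral_poisson_squares:
  assumes f: "sq_integrable a b f" and e: "e > 0" and ab: "a \<le> b"
  defines "M \<equiv> lebesgue_on {a..b}" and "N \<equiv> lebesgue_on {a - 1..b + 1}"
  shows "integrable N (\<lambda>x. (LINT u|M. f u * conj_poisson e (u - x))\<^sup>2)"
    and "integrable N (\<lambda>x. (LINT u|M. f u * poisson e (u - x))\<^sup>2)"
    and "(LINT x|N. (LINT u|M. f u * conj_poisson e (u - x))\<^sup>2) + (LINT x|N. (LINT u|M. f u * poisson e (u - x))\<^sup>2)
      \<le> (2 * pi\<^sup>2 + 2 * (b - a + 1) * (b - a)) * (LINT x|M. (f x)\<^sup>2)"
proof -
  have M: "finite_measure M" and N: "finite_measure N" by (simp_all add: M_def N_def finite_measure_interval)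
  have fi: "integrable M f" "integrable M (\<lambda>x. (f x)\<^sup>2)"
    using f sq_integrable_imp_integrable[OF f] by (auto simp: M_def sq_integrable_def)
  have qm: "(\<lambda>(u, x). conj_poisson e (u - x)) \<in> borel_measurable (M \<Otimes>\<^sub>M N)"
    unfolding M_def N_def by (rule borel_measurable_pair_lebesgue_on) measurable
  have pm: "(\<lambda>(u, x). poisson e (u - x)) \<in> borel_measurable (M \<Otimes>\<^sub>M N)"
    unfolding M_def N_def by (rule borel_measurable_pair_lebesgue_on) measurable
  have pB: "\<bar>poisson e y\<bar> \<le> 1 / e" for y using poisson_bounds[OF e, of y] by simp
  note q = integral_kernel_square[OF M N fi(1) qm poisson_bounds(1)[OF e]]
  note p = integral_kernel_square[OF M N fi(1) pm pB]
  show "integrable N (\<lambda>x. (LINT u|M. f u * conj_poisson e (u - x))\<^sup>2)"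
    and "integrable N (\<lambda>x. (LINT u|M. f u * poisson e (u - x))\<^sup>2)" by (rule q p)+
  define L where "L = (\<lambda>p. (LINT x|N. conj_poisson e (fst p - x) * conj_poisson e (snd p - x))
      + (LINT x|N. poisson e (fst p - x) * poisson e (snd p - x)))"
  define K where "K = (\<lambda>u v. 4 * pi * e / ((u - v)\<^sup>2 + 4 * e\<^sup>2) + 2 * (b - a + 1))"
  have nz: "(u - v)\<^sup>2 + 4 * e\<^sup>2 > 0" for u v using e by (auto intro!: add_nonneg_pos)
  have LK: "\<bar>L (u, v)\<bar> \<le> K u v" if "u \<in> space M" "v \<in> space M" for u v
  proof -
    have uv: "u \<in> {a..b}" "v \<in> {a..b}" using that by (auto simp: M_def)
    have "L (u, v) = (LINT x|N. conj_poisson e (u - x) * conj_poisson e (v - x) + poisson e (u - x) * poisson e (v - x))"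
      unfolding L_def fst_conv snd_conv N_def
    proof (rule Bochner_Integration.integral_add[symmetric])
      have "integrable (lebesgue_on {a - 1..b + 1}) (\<lambda>x. conj_poisson e (u - x))" "integrable (lebesgue_on {a - 1..b + 1}) (\<lambda>x. poisson e (u - x))"
        by (rule integrable_bounded_interval[where B = "1 / e"], 
            auto intro!: borel_measurable_lebesgue_on_borel poisson_bounds[OF e] pB)+
      then show "integrable (lebesgue_on {a - 1..b + 1}) (\<lambda>x. conj_poisson e (u - x) * conj_poisson e (v - x))"
         "integrable (lebesgue_on {a - 1..b + 1}) (\<lambda>x. poisson e (u - x) * poisson e (v - x))"
        by (auto intro!: integrable_times_bounded_borel[where B = "1 / e"] poisson_bounds[OF e] pB)
    qed
    also have "\<dots> = (LINT x|N. ((u - x) * (v - x) + e\<^sup>2) / (((u - x)\<^sup>2 + e\<^sup>2) * ((v - x)\<^sup>2 + e\<^sup>2)))"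
      by (simp add: conj_poisson_def poisson_def add_divide_distrib power2_eq_square)
    finally show ?thesis unfolding K_def N_def using integral_cauchy_kernels[OF e uv] by simp
  qed
  have "(LINT p|(M \<Otimes>\<^sub>M M). f (fst p) * f (snd p) * L p) \<le> (2 * pi\<^sup>2 + 2 * (b - a + 1) * (b - a)) * (LINT x|M. (f x)\<^sup>2)"
  \<comment> \<open>The pointwise bound \<open>B\<close> may blow up with \<open>1 / e\<close>: it
    only secures integrability and does not enter the final constant.\<close>
  proof (rule integral_kernel_Schur[OF M fi, where K = K and B = "pi / e + 2 * (b - a + 1)"])
    show "(\<lambda>(u, v). K u v) \<in> borel_measurable (M \<Otimes>\<^sub>M M)"
      unfolding M_def K_def by (rule borel_measurable_pair_lebesgue_on) measurable
    show "0 \<le> K u v \<and> K u v \<le> pi / e + 2 * (b - a + 1)" for u v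
    proof -
      have "4 * pi * e / ((u - v)\<^sup>2 + 4 * e\<^sup>2) \<le> 4 * pi * e / (4 * e\<^sup>2)"
        using e nz[of u v] by (intro divide_left_mono) auto
      also have "\<dots> = pi / e" using e by (simp add: power2_eq_square)
      finally show ?thesis using e ab by (auto simp: K_def)
    qed
    show "K u v = K v u" for u v by (simp add: K_def power2_commute[of u v])
    show "(LINT v|M. K u v) \<le> 2 * pi\<^sup>2 + 2 * (b - a + 1) * (b - a)" for u
      unfolding M_def K_def by (rule integral_poisson_le[OF e ab])
    show "integrable (M \<Otimes>\<^sub>M M) (\<lambda>p. f (fst p) * f (snd p) * L p)"
      using Bochner_Integration.integrable_add[OF q(3) p(3)] by (simp add: L_def distrib_left)
  qed (rule LK)
  moreover have "(LINT p|(M \<Otimes>\<^sub>M M). f (fst p) * f (snd p) * L p) =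
     (LINT x|N. (LINT u|M. f u * conj_poisson e (u - x))\<^sup>2) + (LINT x|N. (LINT u|M. f u * poisson e (u - x))\<^sup>2)"
    using Bochner_Integration.integral_add[OF q(3) p(3)] unfolding q(2) p(2) by (simp add: L_def distrib_left)
  ultimately show "(LINT x|N. (LINT u|M. f u * conj_poisson e (u - x))\<^sup>2) + (LINT x|N. (LINT u|M. f u * poisson e (u - x))\<^sup>2)
      \<le> (2 * pi\<^sup>2 + 2 * (b - a + 1) * (b - a)) * (LINT x|M. (f x)\<^sup>2)"
    by simp
qed

text \<open>Brings the estimates on the enlarged interval back to \<open>{a..b}\<close>.\<close>

lemma integral_nonneg_subset:
  fixes g :: "real \<Rightarrow> real"
  assumes g: "integrable (lebesgue_on T) g" and "S \<subseteq> T" "S \<in> sets lebesgue" "T \<in> sets lebesgue"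
    and nn: "\<And>x. x \<in> T \<Longrightarrow> 0 \<le> g x"
  shows "integrable (lebesgue_on S) g" "(LINT x|lebesgue_on S. g x) \<le> (LINT x|lebesgue_on T. g x)"
proof -
  have T: "integrable lebesgue (\<lambda>x. indicator T x *\<^sub>R g x)"
    using g assms(4) by (simp add: integrable_restrict_space)
  have eq: "indicator S x *\<^sub>R (indicator T x *\<^sub>R g x) = indicator S x *\<^sub>R g x" for x
    using assms(2) by (auto simp: indicator_def)
  have S: "integrable lebesgue (\<lambda>x. indicator S x *\<^sub>R g x)"
    using integrable_mult_indicator[OF assms(3) T] by (simp only: eq)
  then show "integrable (lebesgue_on S) g" using assms(3) by (simp add: integrable_restrict_space)
  have "(LINT x|lebesgue. indicator S x *\<^sub>R g x) \<le> (LINT x|lebesgue. indicator T x *\<^sub>R g x)"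
    by (rule integral_mono[OF S T]) (use assms(2) nn in \<open>auto simp: indicator_def\<close>)
  then show "(LINT x|lebesgue_on S. g x) \<le> (LINT x|lebesgue_on T. g x)"
    using assms(3,4) by (simp add: integral_restrict_space)
qed

text \<open>Four times the Schur constant: \<open>(\<bar>Q\<bar> + \<bar>P\<bar>)\<^sup>2 \<le> 2 *
  Q\<^sup>2 + 2 * P\<^sup>2\<close>, and each of the two integrals is at most that constant times
  the integral of \<open>f\<^sup>2\<close>.\<close>

definition hilbert_bound :: "real \<Rightarrow> real \<Rightarrow> real" where
  "hilbert_bound a b = 4 * (2 * pi\<^sup>2 + 2 * (b - a + 1) * (b - a))"

lemma sq_integrable_trunc_int:
  assumes f: "sq_integrable a b f" and e: "e > 0"
  shows "sq_integrable a b (\<lambda>z. trunc_int a b f z e)"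
proof -
  let ?M = "lebesgue_on {a..b}"
  interpret M: finite_measure ?M by (rule finite_measure_interval)
  have [measurable]: "f \<in> borel_measurable ?M" using f by (simp add: sq_integrable_def)
  have km: "(\<lambda>(u, z). kern e (u - z)) \<in> borel_measurable (?M \<Otimes>\<^sub>M ?M)"
    by (rule borel_measurable_pair_lebesgue_on) measurable
  have [measurable]: "(\<lambda>p. kern e (snd p - fst p)) \<in> borel_measurable (?M \<Otimes>\<^sub>M ?M)"
    by (rule borel_measurable_pair_lebesgue_on) measurable
  have "(\<lambda>z. trunc_int a b f z e) \<in> borel_measurable ?M"
    unfolding trunc_int_def
    by (rule M.borel_measurable_lebesgue_integral) (simp add: case_prod_unfold)
  moreover have "integrable ?M (\<lambda>z. (trunc_int a b f z e)\<^sup>2)"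
    unfolding trunc_int_def
    by (rule integral_kernel_square(1)[OF finite_measure_interval finite_measure_interval
          sq_integrable_imp_integrable[OF f] km abs_kern_le[OF e]])
  ultimately show ?thesis by (simp add: sq_integrable_def)
qed

lemma integral_trunc_int_square_le:
  assumes f: "sq_integrable a b f" and e: "e > 0" and ab: "a \<le> b"
  shows "(LINT z|lebesgue_on {a..b}. (trunc_int a b f z e)\<^sup>2) \<le> hilbert_bound a b * (LINT x|lebesgue_on {a..b}. (f x)\<^sup>2)"
proof -
  let ?M = "lebesgue_on {a..b}" and ?N = "lebesgue_on {a - 1..b + 1}"
  let ?C = "2 * pi\<^sup>2 + 2 * (b - a + 1) * (b - a)"
  have fa: "sq_integrable a b (\<lambda>x. \<bar>f x\<bar>)" using f by (auto simp: sq_integrable_def)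
  note fi = sq_integrable_imp_integrable[OF f] and fai = sq_integrable_imp_integrable[OF fa]
  define Q where "Q z = (LINT u|?M. f u * conj_poisson e (u - z))" for z
  \<comment> \<open>The error of replacing \<open>kern\<close> by \<open>conj_poisson\<close> is
    known only in absolute value, hence \<open>\<bar>f\<bar>\<close> here.\<close>
  define P where "P z = (LINT u|?M. \<bar>f u\<bar> * poisson e (u - z))" for z
  note q = integral_poisson_squares[OF f e ab, folded Q_def]
  note p = integral_poisson_squares[OF fa e ab, folded P_def]
  have le: "(LINT x|?M. (g x)\<^sup>2) \<le> ?C * (LINT x|?M. (f x)\<^sup>2)"
    if "integrable ?N (\<lambda>x. (g x)\<^sup>2)" "(LINT x|?N. (g x)\<^sup>2) \<le> ?C * (LINT x|?M. (f x)\<^sup>2)" for g :: "real \<Rightarrow> real"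
    using integral_nonneg_subset(2)[OF that(1), of "{a..b}"] that(2) by auto
  have Qi: "integrable ?M (\<lambda>x. (Q x)\<^sup>2)" using integral_nonneg_subset(1)[OF q(1), of "{a..b}"] by simp
  have Pi: "integrable ?M (\<lambda>x. (P x)\<^sup>2)" using integral_nonneg_subset(1)[OF p(2), of "{a..b}"] by simp
  have Q: "(LINT x|?M. (Q x)\<^sup>2) \<le> ?C * (LINT x|?M. (f x)\<^sup>2)"
  proof (rule le[OF q(1)])
    have "0 \<le> (LINT x|?N. (LINT u|?M. f u * poisson e (u - x))\<^sup>2)" by simp
    then show "(LINT x|?N. (Q x)\<^sup>2) \<le> ?C * (LINT x|?M. (f x)\<^sup>2)" using q(3) by linarith
  qed
  have P: "(LINT x|?M. (P x)\<^sup>2) \<le> ?C * (LINT x|?M. (f x)\<^sup>2)"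
  proof (rule le[OF p(2)])
    have "0 \<le> (LINT x|?N. (LINT u|?M. \<bar>f u\<bar> * conj_poisson e (u - x))\<^sup>2)" by simp
    then show "(LINT x|?N. (P x)\<^sup>2) \<le> ?C * (LINT x|?M. (f x)\<^sup>2)" using p(3) unfolding power2_abs by linarith
  qed
  have "(LINT z|?M. (trunc_int a b f z e)\<^sup>2) \<le> (LINT z|?M. 2 * (Q z)\<^sup>2 + 2 * (P z)\<^sup>2)"
  proof (rule integral_mono)
    fix z
    have ik: "integrable ?M (\<lambda>u. f u * kern e (u - z))" by (rule integrable_times_kern[OF fi e])
    have iq: "integrable ?M (\<lambda>u. f u * conj_poisson e (u - z))"
      by (rule integrable_times_bounded_borel[OF fi _ poisson_bounds(1)[OF e]]) measurable
    have ip: "integrable ?M (\<lambda>u. \<bar>f u\<bar> * poisson e (u - z))"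
      by (rule integrable_times_bounded_borel[OF fai, where B = "1 / e"]) (use poisson_bounds[OF e] in auto)
    have "\<bar>trunc_int a b f z e - Q z\<bar> = \<bar>LINT u|?M. f u * kern e (u - z) - f u * conj_poisson e (u - z)\<bar>"
      unfolding trunc_int_def Q_def using ik iq by simp
    also have "\<dots> \<le> (LINT u|?M. \<bar>f u * kern e (u - z) - f u * conj_poisson e (u - z)\<bar>)"
      by (rule integral_abs_bound)
    also have "\<dots> \<le> P z" unfolding P_def
    proof (rule integral_mono)
      fix u
      have "\<bar>f u * kern e (u - z) - f u * conj_poisson e (u - z)\<bar> = \<bar>f u\<bar> * \<bar>kern e (u - z) - conj_poisson e (u - z)\<bar>"
        by (simp add: abs_mult[symmetric] right_diff_distrib)
      then show "\<bar>f u * kern e (u - z) - f u * conj_poisson e (u - z)\<bar> \<le> \<bar>f u\<bar> * poisson e (u - z)"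
        using kern_approx[OF e] by (simp add: mult_left_mono)
    qed (use ik iq ip in auto)
    finally have "\<bar>trunc_int a b f z e\<bar> \<le> \<bar>Q z\<bar> + \<bar>P z\<bar>" by linarith
    then have "(trunc_int a b f z e)\<^sup>2 \<le> (\<bar>Q z\<bar> + \<bar>P z\<bar>)\<^sup>2"
      by (metis abs_ge_zero abs_le_square_iff abs_of_nonneg add_nonneg_nonneg)
    also have "\<dots> \<le> 2 * (Q z)\<^sup>2 + 2 * (P z)\<^sup>2"
      using sum_squares_bound[of "\<bar>Q z\<bar>" "\<bar>P z\<bar>"] by (simp add: power2_sum)
    finally show "(trunc_int a b f z e)\<^sup>2 \<le> 2 * (Q z)\<^sup>2 + 2 * (P z)\<^sup>2" .
  qed (use sq_integrable_trunc_int[OF f e] Qi Pi in \<open>auto simp: sq_integrable_def\<close>)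
  also have "\<dots> = 2 * (LINT z|?M. (Q z)\<^sup>2) + 2 * (LINT z|?M. (P z)\<^sup>2)"
    using Qi Pi by simp
  also have "\<dots> \<le> hilbert_bound a b * (LINT x|?M. (f x)\<^sup>2)"
    unfolding hilbert_bound_def using P Q by (simp only: mult.assoc)
  finally show ?thesis .
qed

text \<open>Almost everywhere convergence together with a bound in \<open>L\<^sup>2\<close> gives weak convergence, by splitting
  \<open>\<bar>g h\<bar> \<le> min \<bar>g h\<bar> (K g\<^sup>2) + h\<^sup>2 / K\<close>.\<close>

lemma weak_tendsto_zero:
  assumes g: "sq_integrable a b g" and h: "\<And>n. sq_integrable a b (h n)"
    and B: "\<And>n. (LINT x|lebesgue_on {a..b}. (h n x)\<^sup>2) \<le> B"
    and lim: "AE x in lebesgue_on {a..b}. (\<lambda>n. h n x) \<longlonglongrightarrow> 0"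
  shows "(\<lambda>n. LINT x|lebesgue_on {a..b}. g x * h n x) \<longlonglongrightarrow> 0"
proof (rule LIMSEQ_I)
  fix r :: real assume r: "r > 0"
  let ?M = "lebesgue_on {a..b}"
  have "0 \<le> (LINT x|?M. (h 0 x)\<^sup>2)" by simp
  then have B0: "B \<ge> 0" using B[of 0] by (rule order_trans)
  \<comment> \<open>Large enough for \<open>B / K < r / 2\<close>, so the part
    \<open>h\<^sup>2 / K\<close> costs less than half of \<open>r\<close> for every
    \<open>n\<close>; the other part has the fixed majorant \<open>K * g\<^sup>2\<close>.\<close>
  define K where "K = 2 * B / r + 1"
  have K: "K > 0" using B0 r by (auto simp: K_def intro!: add_nonneg_pos)
  have BK: "B / K < r / 2"
  proof -
    have "B < r / 2 * K" using r by (simp add: K_def field_simps)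
    then show ?thesis using K by (simp add: divide_less_eq)
  qed
  have [measurable]: "g \<in> borel_measurable ?M" "h n \<in> borel_measurable ?M" for n
    using g h by (auto simp: sq_integrable_def)
  let ?m = "\<lambda>n x. min \<bar>g x * h n x\<bar> (K * (g x)\<^sup>2)"
  have bnd: "AE x in ?M. norm (?m n x) \<le> K * (g x)\<^sup>2" for n
    using K by (intro AE_I2) (auto simp: min_def)
  have gi: "integrable ?M (\<lambda>x. K * (g x)\<^sup>2)" using g by (simp add: sq_integrable_def)
  have mi: "integrable ?M (?m n)" for n
    by (rule Bochner_Integration.integrable_bound[OF gi]) (use bnd[of n] K in auto)
  have "(\<lambda>n. integral\<^sup>L ?M (?m n)) \<longlonglongrightarrow> integral\<^sup>L ?M (\<lambda>x. 0)"
  proof (rule integral_dominated_convergence[OF _ _ gi _ bnd])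
    show "AE x in ?M. (\<lambda>n. ?m n x) \<longlonglongrightarrow> 0"
      using lim
    proof eventually_elim
      case (elim x)
      have "(\<lambda>n. \<bar>g x * h n x\<bar>) \<longlonglongrightarrow> 0"
        using tendsto_rabs[OF tendsto_mult[OF tendsto_const elim, of "g x"]] by simp
      moreover have "min 0 (K * (g x)\<^sup>2) = 0" using K by simp
      ultimately show ?case
        using tendsto_min[OF _ tendsto_const, of "\<lambda>n. \<bar>g x * h n x\<bar>" 0 sequentially "K * (g x)\<^sup>2"] by simp
    qed
  qed measurable
  then have "(\<lambda>n. integral\<^sup>L ?M (?m n)) \<longlonglongrightarrow> 0" by simp
  from LIMSEQ_D[OF this, of "r / 2"] r obtain n0 where
    n0: "\<And>n. n \<ge> n0 \<Longrightarrow> \<bar>integral\<^sup>L ?M (?m n)\<bar> < r / 2" by auto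
  have "\<bar>LINT x|?M. g x * h n x\<bar> < r" if "n \<ge> n0" for n
  proof -
    have hi: "integrable ?M (\<lambda>x. (h n x)\<^sup>2)" using h by (simp add: sq_integrable_def)
    have "\<bar>LINT x|?M. g x * h n x\<bar> \<le> (LINT x|?M. \<bar>g x * h n x\<bar>)" by (rule integral_abs_bound)
    also have "\<dots> \<le> (LINT x|?M. ?m n x + (h n x)\<^sup>2 / K)"
    proof (rule integral_mono)
      fix x
      show "\<bar>g x * h n x\<bar> \<le> ?m n x + (h n x)\<^sup>2 / K"
      proof (cases "\<bar>h n x\<bar> \<le> K * \<bar>g x\<bar>")
        case True
        then have "\<bar>g x\<bar> * \<bar>h n x\<bar> \<le> \<bar>g x\<bar> * (K * \<bar>g x\<bar>)" by (intro mult_left_mono) auto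
        then have "\<bar>g x * h n x\<bar> \<le> K * (g x)\<^sup>2" by (simp add: abs_mult power2_eq_square mult_ac)
        then show ?thesis using K by (simp add: min_def)
      next
        case False
        then have "(K * \<bar>g x\<bar>) * \<bar>h n x\<bar> \<le> \<bar>h n x\<bar> * \<bar>h n x\<bar>" by (intro mult_right_mono) auto
        then have "\<bar>g x * h n x\<bar> \<le> (h n x)\<^sup>2 / K"
          using K by (simp add: abs_mult power2_eq_square le_divide_eq mult_ac)
        moreover have "?m n x \<ge> 0" using K by simp
        ultimately show ?thesis by linarith
      qed
    qed (use mi[of n] hi sq_integrable_mult[OF g h[of n]] in auto)
    also have "\<dots> = integral\<^sup>L ?M (?m n) + (LINT x|?M. (h n x)\<^sup>2) / K"
      using mi[of n] hi by simp
    also have "(LINT x|?M. (h n x)\<^sup>2) / K \<le> B / K" using B K by (intro divide_right_mono) auto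
    finally show ?thesis using n0[OF that] BK by linarith
  qed
  then show "\<exists>no. \<forall>n\<ge>no. norm ((LINT x|?M. g x * h n x) - 0) < r" by auto
qed

lemma integral_mult_trunc_int:
  assumes f: "sq_integrable a b f" and g: "sq_integrable a b g" and e: "e > 0"
  shows "(LINT z|lebesgue_on {a..b}. g z * trunc_int a b f z e) = - (LINT z|lebesgue_on {a..b}. f z * trunc_int a b g z e)"
proof -
  let ?M = "lebesgue_on {a..b}"
  interpret M: finite_measure ?M by (rule finite_measure_interval)
  interpret MM: pair_sigma_finite ?M ?M ..
  have [measurable]: "f \<in> borel_measurable ?M" "g \<in> borel_measurable ?M" using f g by (auto simp: sq_integrable_def)
  have [measurable]: "(\<lambda>p. kern e (snd p - fst p)) \<in> borel_measurable (?M \<Otimes>\<^sub>M ?M)"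
    by (rule borel_measurable_pair_lebesgue_on) measurable
  have "integrable (?M \<Otimes>\<^sub>M ?M) (\<lambda>(z, u). 1 / e * (g z * f u))"
    using integrable_pair_mult[OF M.sigma_finite_measure_axioms M.sigma_finite_measure_axioms
      sq_integrable_imp_integrable[OF g] sq_integrable_imp_integrable[OF f]]
    by (simp add: case_prod_unfold)
  then have i: "integrable (?M \<Otimes>\<^sub>M ?M) (\<lambda>(z, u). g z * (f u * kern e (u - z)))"
  proof (rule Bochner_Integration.integrable_bound)
    show "AE p in ?M \<Otimes>\<^sub>M ?M. norm (case p of (z, u) \<Rightarrow> g z * (f u * kern e (u - z))) \<le> norm (case p of (z, u) \<Rightarrow> 1 / e * (g z * f u))"
    proof (rule AE_I2, clarify)
      fix z u
      have "\<bar>kern e (u - z)\<bar> * \<bar>g z * f u\<bar> \<le> 1 / e * \<bar>g z * f u\<bar>"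
        by (intro mult_right_mono abs_kern_le[OF e]) auto
      then show "norm (g z * (f u * kern e (u - z))) \<le> norm (1 / e * (g z * f u))"
        using e by (simp add: abs_mult mult_ac)
    qed
  qed (simp add: case_prod_unfold)
  have "(LINT z|?M. g z * trunc_int a b f z e) = (LINT z|?M. LINT u|?M. g z * (f u * kern e (u - z)))"
    by (simp add: trunc_int_def)
  also have "\<dots> = (LINT u|?M. LINT z|?M. g z * (f u * kern e (u - z)))"
    by (rule MM.Fubini_integral[OF i, symmetric])
  also have "\<dots> = (LINT u|?M. LINT z|?M. - (f u * (g z * kern e (z - u))))"
  proof -
    have "g z * (f u * kern e (u - z)) = - (f u * (g z * kern e (z - u)))" for u z
    proof -
      have "kern e (u - z) = - kern e (z - u)" using kern_minus[of e "z - u"] by simp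
      then show ?thesis by (simp only: mult_minus_right mult.left_commute)
    qed
    then show ?thesis by (simp only:)
  qed
  also have "\<dots> = - (LINT z|?M. f z * trunc_int a b g z e)"
    by (simp add: trunc_int_def)
  finally show ?thesis .
qed

lemma tendsto_integral_mult_trunc_int:
  assumes f: "sq_integrable a b f" and g: "sq_integrable a b g" and F: "sq_integrable a b F" and ab: "a \<le> b"
    and lim: "AE z in lebesgue_on {a..b}. (trunc_int a b f z \<longlongrightarrow> F z) (at_right 0)"
  shows "(\<lambda>n. LINT z|lebesgue_on {a..b}. g z * trunc_int a b f z (inverse (real (Suc n))))
    \<longlonglongrightarrow> (LINT z|lebesgue_on {a..b}. g z * F z)"
proof -
  let ?M = "lebesgue_on {a..b}"
  let ?T = "\<lambda>n z. trunc_int a b f z (inverse (real (Suc n)))"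
  have T: "sq_integrable a b (?T n)" for n by (rule sq_integrable_trunc_int[OF f]) simp
  have seq: "filterlim (\<lambda>n. inverse (real (Suc n))) (at_right 0) sequentially"
    by (auto simp: filterlim_at simp del: of_nat_Suc intro!: LIMSEQ_inverse_real_of_nat always_eventually)
  have "(\<lambda>n. LINT z|?M. g z * (?T n z - F z)) \<longlonglongrightarrow> 0"
  proof (rule weak_tendsto_zero[OF g])
    show "sq_integrable a b (\<lambda>z. ?T n z - F z)" for n by (rule sq_integrable_diff[OF T F])
    show "(LINT z|?M. (?T n z - F z)\<^sup>2) \<le> 2 * (hilbert_bound a b * (LINT x|?M. (f x)\<^sup>2)) + 2 * (LINT x|?M. (F x)\<^sup>2)" for n
    proof -
      have i: "integrable ?M (\<lambda>z. (?T n z)\<^sup>2)" "integrable ?M (\<lambda>z. (F z)\<^sup>2)"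
        using T[of n] F by (auto simp: sq_integrable_def)
      have "(LINT z|?M. (?T n z - F z)\<^sup>2) \<le> (LINT z|?M. 2 * (?T n z)\<^sup>2 + 2 * (F z)\<^sup>2)"
      proof (rule integral_mono)
        fix z
        have "0 \<le> (?T n z + F z)\<^sup>2" by simp
        then show "(?T n z - F z)\<^sup>2 \<le> 2 * (?T n z)\<^sup>2 + 2 * (F z)\<^sup>2"
          unfolding power2_sum power2_diff by linarith
      qed (use i sq_integrable_diff[OF T F] in \<open>auto simp: sq_integrable_def\<close>)
      also have "\<dots> = 2 * (LINT z|?M. (?T n z)\<^sup>2) + 2 * (LINT z|?M. (F z)\<^sup>2)" using i by simp
      finally show ?thesis using integral_trunc_int_square_le[OF f _ ab, of "inverse (real (Suc n))"] by simp
    qed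
    show "AE z in ?M. (\<lambda>n. ?T n z - F z) \<longlonglongrightarrow> 0"
      using lim by eventually_elim (rule LIM_zero, rule filterlim_compose[OF _ seq])
  qed
  then have "(\<lambda>n. (LINT z|?M. g z * ?T n z) - (LINT z|?M. g z * F z)) \<longlonglongrightarrow> 0"
    using sq_integrable_mult[OF g T] sq_integrable_mult[OF g F] by (simp add: right_diff_distrib)
  then show ?thesis by (rule LIM_zero_cancel)
qed

text \<open>Both sides of \<open>integral_mult_trunc_int\<close> converge along the cutoffs
  \<open>1 / (n + 1)\<close>; a sequence is chosen because \<open>weak_tendsto_zero\<close> speaks
  of sequences.\<close>

theorem pv_duality:
  assumes "sq_integrable a b f" "sq_integrable a b g" "sq_integrable a b F" "sq_integrable a b G" "a \<le> b"
    and "AE z in lebesgue_on {a..b}. (trunc_int a b f z \<longlongrightarrow> F z) (at_right 0)"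
    and "AE z in lebesgue_on {a..b}. (trunc_int a b g z \<longlongrightarrow> G z) (at_right 0)"
  shows "(LINT z|lebesgue_on {a..b}. g z * F z) = - (LINT z|lebesgue_on {a..b}. f z * G z)"
proof (rule LIMSEQ_unique)
  show "(\<lambda>n. LINT z|lebesgue_on {a..b}. g z * trunc_int a b f z (inverse (real (Suc n))))
    \<longlonglongrightarrow> (LINT z|lebesgue_on {a..b}. g z * F z)"
    by (rule tendsto_integral_mult_trunc_int) fact+
  have "(\<lambda>n. - (LINT z|lebesgue_on {a..b}. f z * trunc_int a b g z (inverse (real (Suc n)))))
    \<longlonglongrightarrow> - (LINT z|lebesgue_on {a..b}. f z * G z)"
    by (intro tendsto_minus tendsto_integral_mult_trunc_int) fact+
  then show "(\<lambda>n. LINT z|lebesgue_on {a..b}. g z * trunc_int a b f z (inverse (real (Suc n))))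
    \<longlonglongrightarrow> - (LINT z|lebesgue_on {a..b}. f z * G z)"
    using integral_mult_trunc_int[OF assms(1,2)] by simp
qed

subsection \<open>Constants are not in the range\<close>

lemma AE_interior_interval: "AE z in lebesgue_on {a..b::real}. z \<in> {a<..<b}"
proof -
  have "AE x in lebesgue. x \<noteq> z" for z :: real
    by (intro AE_completion AE_lborel_singleton)
  from this[of a] this[of b] have "AE x in lebesgue. x \<in> {a..b} \<longrightarrow> x \<in> {a<..<b}"
    by eventually_elim auto
  then show ?thesis by (subst AE_restrict_space_iff) auto
qed

lemma integral_inverse_square:
  fixes a b w :: real
  assumes ab: "a \<le> b" and w: "w \<notin> {a..b}"
  shows "(LINT z|lebesgue_on {a..b}. 1 / (w - z)\<^sup>2) = (b - a) / ((w - a) * (w - b))"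
proof -
  have nz: "w - z \<noteq> 0" if "z \<in> {a..b}" for z using that w by auto
  have "((\<lambda>z. 1 / (w - z)\<^sup>2) has_integral (1 / (w - b) - 1 / (w - a))) {a..b}"
  proof (rule fundamental_theorem_of_calculus[OF ab])
    fix z assume z: "z \<in> {a..b}"
    have "((\<lambda>z. 1 / (w - z)) has_real_derivative 1 / (w - z)\<^sup>2) (at z within {a..b})"
      using nz[OF z] by (auto intro!: derivative_eq_intros simp: power2_eq_square)
    then show "((\<lambda>z. 1 / (w - z)) has_vector_derivative 1 / (w - z)\<^sup>2) (at z within {a..b})"
      by (simp add: has_real_derivative_iff_has_vector_derivative)
  qed
  moreover have "integrable (lebesgue_on {a..b}) (\<lambda>z. 1 / (w - z)\<^sup>2)"
    using nz by (intro continuous_imp_integrable_real continuous_intros) auto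
  ultimately have "(LINT z|lebesgue_on {a..b}. 1 / (w - z)\<^sup>2) = 1 / (w - b) - 1 / (w - a)"
    by (subst lebesgue_integral_eq_integral) (auto dest: integral_unique)
  also have "\<dots> = (b - a) / ((w - a) * (w - b))"
    using nz[of a] nz[of b] ab by (simp add: field_simps)
  finally show ?thesis .
qed

lemma sq_integrable_continuous:
  assumes "continuous_on {a..b} f"
  shows "sq_integrable a b f"
  unfolding sq_integrable_def
  using continuous_imp_integrable_real[OF assms] continuous_imp_integrable_real[OF continuous_on_power[OF assms, of 2]]
  by (auto dest: borel_measurable_integrable)

text \<open>Duality with the test function \<open>arch a b x / (x - w)\<close>. The -1 in its
  transform \<open>pi * (outer_root a b w / (w - z) - 1)\<close> is what produces the integral of
  \<open>f\<close>.\<close>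

lemma pv_const_test:
  assumes ab: "a < b" and f: "sq_integrable a b f"
    and lim: "AE z in lebesgue_on {a..b}. (trunc_int a b f z \<longlongrightarrow> c) (at_right 0)"
    and w: "w \<notin> {a..b}"
  shows "c * ((a + b) / 2 - w + outer_root a b w) =
    (LINT z|lebesgue_on {a..b}. f z) - (LINT z|lebesgue_on {a..b}. f z * (outer_root a b w / (w - z)))"
proof -
  let ?M = "lebesgue_on {a..b}" and ?E = "outer_root a b w"
  have nz: "w - z \<noteq> 0" if "z \<in> {a..b}" for z using that w by auto
  have t: "sq_integrable a b (\<lambda>x. arch a b x / (x - w))"
    using w by (intro sq_integrable_continuous continuous_intros continuous_on_arch) auto
  have h: "sq_integrable a b (\<lambda>z. ?E / (w - z))"
    using nz by (intro sq_integrable_continuous continuous_intros) auto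
  have G: "sq_integrable a b (\<lambda>z. pi * (?E / (w - z) - 1))"
    by (intro sq_integrable_cmult sq_integrable_diff h sq_integrable_const)
  have "(LINT z|?M. (arch a b z / (z - w)) * c) = - (LINT z|?M. f z * (pi * (?E / (w - z) - 1)))"
  proof (rule pv_duality[OF f t sq_integrable_const G _ lim])
    show "AE z in ?M. (trunc_int a b (\<lambda>x. arch a b x / (x - w)) z \<longlongrightarrow> pi * (?E / (w - z) - 1)) (at_right 0)"
      using AE_interior_interval by eventually_elim (rule tendsto_trunc_int_arch_over_diff[OF w])
  qed (use ab in simp)
  also have "(LINT z|?M. (arch a b z / (z - w)) * c) = pi * (c * ((a + b) / 2 - w + ?E))"
    by (subst integral_mult_left_zero, subst integral_arch_over_diff[OF ab w]) simp
  also have "(LINT z|?M. f z * (pi * (?E / (w - z) - 1))) = (LINT z|?M. pi * (f z * (?E / (w - z)) - f z))"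
    by (simp add: algebra_simps)
  also have "\<dots> = pi * ((LINT z|?M. f z * (?E / (w - z))) - (LINT z|?M. f z))"
    using sq_integrable_mult[OF f h] sq_integrable_imp_integrable[OF f] by simp
  finally have "pi * (c * ((a + b) / 2 - w + ?E)) = pi * ((LINT z|?M. f z) - (LINT z|?M. f z * (?E / (w - z))))"
    by (simp add: right_diff_distrib)
  then show ?thesis by simp
qed

text \<open>The integral of \<open>1 / (w - z)\<^sup>2\<close> is \<open>b - a\<close> divided by
  the square of \<open>outer_root a b w\<close>, so \<open>outer_root a b w / (w - z)\<close> has
  squared L2 norm \<open>b - a\<close> for every \<open>w\<close>. It vanishes pointwise in the
  limit, hence weakly, and drops out of \<open>pv_const_test\<close>.\<close>

lemma pv_const_endpoint:
  assumes ab: "a < b" and f: "sq_integrable a b f"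
    and lim: "AE z in lebesgue_on {a..b}. (trunc_int a b f z \<longlongrightarrow> c) (at_right 0)"
    and w: "\<And>n. w n \<notin> {a..b}" and wp: "w \<longlonglongrightarrow> p" and p: "p = a \<or> p = b"
  shows "c * ((a + b) / 2 - p) = (LINT z|lebesgue_on {a..b}. f z)"
proof -
  let ?M = "lebesgue_on {a..b}" and ?E = "\<lambda>n. outer_root a b (w n)"
  have nz: "w n - z \<noteq> 0" if "z \<in> {a..b}" for n z using that w[of n] by auto
  have E0: "?E \<longlonglongrightarrow> 0"
  \<comment> \<open>The sign of the root depends on the side of the interval; its absolute value has
    one continuous formula.\<close>
  proof (rule tendsto_rabs_zero_cancel)
    have "(\<lambda>n. sqrt \<bar>(w n - a) * (w n - b)\<bar>) \<longlonglongrightarrow> sqrt \<bar>(p - a) * (p - b)\<bar>"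
      by (intro tendsto_intros wp)
    moreover have "\<bar>?E n\<bar> = sqrt \<bar>(w n - a) * (w n - b)\<bar>" for n
      using outer_root_square[OF less_imp_le[OF ab] w[of n], symmetric] by simp
    ultimately show "(\<lambda>n. \<bar>?E n\<bar>) \<longlonglongrightarrow> 0" using p by auto
  qed
  have h: "sq_integrable a b (\<lambda>z. ?E n / (w n - z))" for n
    using nz by (intro sq_integrable_continuous continuous_intros) auto
  have "(\<lambda>n. LINT z|?M. f z * (?E n / (w n - z))) \<longlonglongrightarrow> 0"
  proof (rule weak_tendsto_zero[OF f h])
    show "(LINT z|?M. (?E n / (w n - z))\<^sup>2) \<le> b - a" for n
    proof -
      have "(LINT z|?M. (?E n / (w n - z))\<^sup>2) = (LINT z|?M. (?E n)\<^sup>2 * (1 / (w n - z)\<^sup>2))"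
        by (simp add: power_divide)
      also have "\<dots> = (?E n)\<^sup>2 * ((b - a) / ((w n - a) * (w n - b)))"
        by (subst integral_mult_right_zero, subst integral_inverse_square) (use ab w in auto)
      also have "\<dots> = b - a"
        using outer_root_square[of a b "w n"] ab w[of n] nz[of a n] nz[of b n] by simp
      finally show ?thesis by simp
    qed
    show "AE z in ?M. (\<lambda>n. ?E n / (w n - z)) \<longlonglongrightarrow> 0"
      using AE_interior_interval
    proof eventually_elim
      case (elim z)
      then have "p - z \<noteq> 0" using p by auto
      then show ?case using tendsto_divide[OF E0 tendsto_diff[OF wp tendsto_const]] by simp
    qed
  qed
  then have "(\<lambda>n. (LINT z|?M. f z) - (LINT z|?M. f z * (?E n / (w n - z)))) \<longlonglongrightarrow> (LINT z|?M. f z) - 0"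
    by (intro tendsto_diff tendsto_const)
  moreover have "(\<lambda>n. c * ((a + b) / 2 - w n + ?E n)) \<longlonglongrightarrow> c * ((a + b) / 2 - p + 0)"
    by (intro tendsto_intros wp E0) simp
  ultimately have "c * ((a + b) / 2 - p + 0) = (LINT z|?M. f z) - 0"
    unfolding pv_const_test[OF ab f lim w] by (rule LIMSEQ_unique[rotated])
  then show ?thesis by simp
qed

theorem pv_const_eq_0:
  assumes ab: "a < b" and f: "sq_integrable a b f"
    and lim: "AE z in lebesgue_on {a..b}. (trunc_int a b f z \<longlongrightarrow> c) (at_right 0)"
  shows "c = 0"
proof -
  let ?i = "\<lambda>n. inverse (real (Suc n))"
  have pos: "?i n > 0" for n by simp
  have "(\<lambda>n. b + ?i n) \<longlonglongrightarrow> b + 0" "(\<lambda>n. a - ?i n) \<longlonglongrightarrow> a - 0"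
    by (intro tendsto_intros LIMSEQ_inverse_real_of_nat)+
  then have l: "(\<lambda>n. b + ?i n) \<longlonglongrightarrow> b" "(\<lambda>n. a - ?i n) \<longlonglongrightarrow> a"
    by (simp_all only: add_0_right diff_0_right)
  have n: "b + ?i n \<notin> {a..b}" "a - ?i n \<notin> {a..b}" for n
    using pos[of n] unfolding atLeastAtMost_iff by linarith+
  have "c * ((a + b) / 2 - b) = (LINT z|lebesgue_on {a..b}. f z)"
    by (rule pv_const_endpoint[OF ab f lim n(1) l(1)]) simp
  moreover have "c * ((a + b) / 2 - a) = (LINT z|lebesgue_on {a..b}. f z)"
    by (rule pv_const_endpoint[OF ab f lim n(2) l(2)]) simp
  ultimately have "c * ((a + b) / 2 - b) = c * ((a + b) / 2 - a)" by simp
  then have "c * (b - a) = 0" by (auto simp: field_simps)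
  then show ?thesis using ab by simp
qed

subsection \<open>Sources on a disjoint interval\<close>

lemma separated_intervals:
  fixes a b c d :: real
  assumes "d < a \<or> b < c"
  obtains \<delta> where "\<delta> > 0" "\<And>w x. w \<in> {c..d} \<Longrightarrow> x \<in> {a..b} \<Longrightarrow> \<delta> \<le> \<bar>x - w\<bar>"
proof (cases "d < a")
  case True
  then show ?thesis by (intro that[of "a - d"]) auto
next
  case False
  then show ?thesis using assms by (intro that[of "c - b"]) auto
qed

text \<open>The solution for the right-hand side \<open>1 / (w - z)\<close> is \<open>arch a b x / ((x - w) * outer_root a b w)\<close>, up to
  the constant \<open>1 / outer_root a b w\<close>; superposing these with density \<open>f\<close> gives the following.\<close>

theorem pv_solution_exterior:
  fixes a b c d :: real
  assumes ab: "a < b" and cd: "d < a \<or> b < c" and f: "integrable (lebesgue_on {c..d}) f"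
  obtains g \<kappa> where "sq_integrable a b g"
    "\<And>z. z \<in> {a<..<b} \<Longrightarrow> (trunc_int a b g z \<longlongrightarrow> (LINT w|lebesgue_on {c..d}. f w / (w - z)) - \<kappa>) (at_right 0)"
proof -
  let ?M = "lebesgue_on {a..b}" and ?N = "lebesgue_on {c..d}"
  interpret M: finite_measure ?M by (rule finite_measure_interval)
  interpret N: finite_measure ?N by (rule finite_measure_interval)
  interpret NM: pair_sigma_finite ?N ?M ..
  obtain \<delta> where \<delta>: "\<delta> > 0" "\<And>w x. w \<in> {c..d} \<Longrightarrow> x \<in> {a..b} \<Longrightarrow> \<delta> \<le> \<bar>x - w\<bar>"
    using separated_intervals[OF cd] by blast
  have w: "w \<notin> {a..b}" if "w \<in> {c..d}" for w using that cd by auto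
  let ?E = "outer_root a b" and ?t = "\<lambda>w x. arch a b x / (x - w)"
  have archm [measurable]: "arch a b \<in> borel_measurable borel"
    by (intro borel_measurable_continuous_onI continuous_on_arch)
  have archB: "\<bar>arch a b x\<bar> \<le> b - a" if "x \<in> {a..b}" for x
  proof -
    have "(x - a) * (b - x) \<le> (b - a) * (b - a)" using that by (intro mult_mono) auto
    then have "sqrt ((x - a) * (b - x)) \<le> sqrt ((b - a) * (b - a))" by (rule real_sqrt_le_mono)
    then show ?thesis using that ab by (simp add: arch_def)
  qed
  have tB: "\<bar>?t w x\<bar> \<le> (b - a) / \<delta>" if "w \<in> {c..d}" "x \<in> {a..b}" for w x
    unfolding abs_divide using \<delta>(1) \<delta>(2)[OF that] archB[OF that(2)] ab by (intro frac_le) auto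
  \<comment> \<open>The endpoints \<open>a\<close> and \<open>b\<close> themselves have distance at
    least \<open>\<delta>\<close> from \<open>w\<close>, and the square of the root is the product
    of these distances.\<close>
  have EB: "\<bar>1 / ?E w\<bar> \<le> 1 / \<delta>" if "w \<in> {c..d}" for w
  proof -
    have "\<delta> * \<delta> \<le> \<bar>a - w\<bar> * \<bar>b - w\<bar>"
      using \<delta>(1) \<delta>(2)[OF that, of a] \<delta>(2)[OF that, of b] ab by (intro mult_mono) auto
    also have "\<dots> = \<bar>(w - a) * (w - b)\<bar>" by (simp add: abs_mult abs_minus_commute)
    also have "\<dots> = \<bar>?E w\<bar>\<^sup>2" using outer_root_square[of a b w, symmetric] w[OF that] ab by simp
    finally have "\<delta> \<le> \<bar>?E w\<bar>" using \<delta>(1) by (intro power2_le_imp_le[of \<delta>]) (auto simp: power2_eq_square)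
    then show ?thesis using \<delta>(1) by (simp add: frac_le)
  qed
  \<comment> \<open>Dividing the density by the root normalises each elementary solution; the
    integral of \<open>F\<close> becomes the constant \<open>\<kappa>\<close>.\<close>
  define F where "F = (\<lambda>w. f w * (1 / ?E w))"
  have Fi: "integrable ?N F" unfolding F_def
    by (rule integrable_mult_bounded_interval[OF f _ EB]) (auto intro!: borel_measurable_lebesgue_on_borel)
  then have Fm [measurable]: "F \<in> borel_measurable ?N" by simp
  define g where "g = (\<lambda>x. 1 / pi * (LINT w|?N. F w * ?t w x))"
  have tm [measurable]: "(\<lambda>p. ?t (snd p) (fst p)) \<in> borel_measurable (?M \<Otimes>\<^sub>M ?N)"
    by (rule borel_measurable_pair_lebesgue_on) measurable
  have tkm: "(\<lambda>p. ?t (fst p) (snd p) * kern e (snd p - z)) \<in> borel_measurable (?N \<Otimes>\<^sub>M ?M)" for e z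
    by (rule borel_measurable_pair_lebesgue_on) measurable
  have Ftm: "(\<lambda>(x, w). F w * ?t w x) \<in> borel_measurable (?M \<Otimes>\<^sub>M ?N)"
    unfolding case_prod_unfold
    by (intro borel_measurable_times measurable_compose[OF measurable_snd Fm] tm)
  have "sq_integrable a b g"
  proof (rule sq_integrable_bounded)
    show "g \<in> borel_measurable ?M" unfolding g_def
      by (intro borel_measurable_times borel_measurable_const N.borel_measurable_lebesgue_integral Ftm)
    fix x assume x: "x \<in> {a..b}"
    have "\<bar>LINT w|?N. F w * ?t w x\<bar> \<le> (LINT w|?N. \<bar>F w * ?t w x\<bar>)" by (rule integral_abs_bound)
    also have "\<dots> \<le> (LINT w|?N. \<bar>F w\<bar> * ((b - a) / \<delta>))"
    proof (rule integral_mono)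
      show "integrable ?N (\<lambda>w. \<bar>F w * ?t w x\<bar>)"
        by (intro integrable_abs integrable_mult_bounded_interval[OF Fi _ tB[OF _ x]] borel_measurable_lebesgue_on_borel) measurable
      fix w' assume "w' \<in> space ?N"
      then have "\<bar>?t w' x\<bar> \<le> (b - a) / \<delta>" by (intro tB x) simp
      then show "\<bar>F w' * ?t w' x\<bar> \<le> \<bar>F w'\<bar> * ((b - a) / \<delta>)"
        unfolding abs_mult[of "F w'"] by (rule mult_left_mono) simp
    qed (use Fi in simp)
    finally show "\<bar>g x\<bar> \<le> 1 / pi * (LINT w|?N. \<bar>F w\<bar> * ((b - a) / \<delta>))"
      unfolding g_def abs_mult by (intro mult_mono) auto
  qed
  moreover have "(trunc_int a b g z \<longlongrightarrow> (LINT w|?N. f w / (w - z)) - (LINT w|?N. F w)) (at_right 0)"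
    if z: "z \<in> {a<..<b}" for z
  proof -
    let ?T = "\<lambda>e w. trunc_int a b (?t w) z e"
    have fub: "trunc_int a b g z e = 1 / pi * (LINT w|?N. F w * ?T e w)" if e: "e > 0" for e
    proof -
      have i: "integrable (?N \<Otimes>\<^sub>M ?M) (\<lambda>(w, x). F w * (?t w x * kern e (x - z)))"
      proof -
        have "\<bar>?t (fst p) (snd p) * kern e (snd p - z)\<bar> \<le> (b - a) / \<delta> * (1 / e)"
          if "p \<in> space (?N \<Otimes>\<^sub>M ?M)" for p
          unfolding abs_mult using that \<delta>(1) ab
          by (intro mult_mono tB abs_kern_le[OF e]) (auto simp: space_pair_measure)
        from integrable_pair_bounded[OF N.sigma_finite_measure_axioms finite_measure_interval Fi tkm this]
        show ?thesis by simp
      qed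
      have "trunc_int a b g z e = (LINT x|?M. 1 / pi * (LINT w|?N. F w * (?t w x * kern e (x - z))))"
        unfolding trunc_int_def g_def mult.assoc integral_mult_left_zero[symmetric] ..
      also have "\<dots> = 1 / pi * (LINT x|?M. LINT w|?N. F w * (?t w x * kern e (x - z)))"
        by (rule integral_mult_right_zero)
      also have "(LINT x|?M. LINT w|?N. F w * (?t w x * kern e (x - z))) = (LINT w|?N. LINT x|?M. F w * (?t w x * kern e (x - z)))"
        by (rule NM.Fubini_integral[OF i])
      also have "\<dots> = (LINT w|?N. F w * ?T e w)"
        unfolding trunc_int_def by (simp only: integral_mult_right_zero)
      finally show ?thesis .
    qed
    let ?L = "pi * ((a + b) / 2 - z)"
    \<comment> \<open>A convergent quantity is bounded for small \<open>e\<close>; this one does not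
      involve \<open>w\<close>, so it helps to dominate the integrand uniformly in
      \<open>w\<close>.\<close>
    have "\<forall>\<^sub>F e in at_right 0. dist (trunc_int a b (arch a b) z e) ?L < 1"
      using tendsto_trunc_int_arch[OF z] by (rule tendstoD) simp
    then obtain e0 where e0: "e0 > 0" "\<And>e. e \<in> {0<..<e0} \<Longrightarrow> dist (trunc_int a b (arch a b) z e) ?L < 1"
      unfolding eventually_at_right_field by auto
    have "((\<lambda>e. LINT w|?N. F w * ?T e w) \<longlongrightarrow> (LINT w|?N. F w * (pi * (?E w / (w - z) - 1)))) (at_right 0)"
    proof (rule integral_dominated_convergence_at_right[OF _ _ _ _ _ e0(1)])
      have "(\<lambda>w. pi * (?E w / (w - z) - 1)) \<in> borel_measurable ?N"
        by (rule borel_measurable_lebesgue_on_borel) measurable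
      then show "(\<lambda>w. F w * (pi * (?E w / (w - z) - 1))) \<in> borel_measurable ?N" by measurable
      show "(\<lambda>w. F w * ?T e w) \<in> borel_measurable ?N" for e
        unfolding trunc_int_def
        by (intro borel_measurable_times Fm M.borel_measurable_lebesgue_integral) (use tkm in \<open>simp only: case_prod_unfold\<close>)
      \<comment> \<open>From the partial fraction formula: bounds for the two integrals in the
        numerator, over the lower bound \<open>\<delta>\<close> of
        \<open>\<bar>w - z\<bar>\<close>.\<close>
      let ?B = "((b - a) * ((b - a) / \<delta>) + (\<bar>?L\<bar> + 1)) / \<delta>"
      show "integrable ?N (\<lambda>w. \<bar>F w\<bar> * ?B)" using Fi by simp
      show "AE w in ?N. ((\<lambda>e. F w * ?T e w) \<longlongrightarrow> F w * (pi * (?E w / (w - z) - 1))) (at_right 0)"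
        by (intro AE_I2 tendsto_mult tendsto_const tendsto_trunc_int_arch_over_diff z w) simp
      fix e :: real assume e: "e \<in> {0<..<e0}"
      show "AE w in ?N. norm (F w * ?T e w) \<le> \<bar>F w\<bar> * ?B"
      proof (rule AE_I2)
        fix w' assume "w' \<in> space ?N"
        then have w': "w' \<in> {c..d}" by simp
        let ?I = "LINT x|?M. ?t w' x * (if \<bar>x - z\<bar> < e then 0 else 1)"
        have "\<bar>?I\<bar> \<le> (LINT x|?M. \<bar>?t w' x * (if \<bar>x - z\<bar> < e then 0 else 1)\<bar>)" by (rule integral_abs_bound)
        also have "\<dots> \<le> (LINT x|?M. (b - a) / \<delta>)"
        proof (rule integral_mono)
          show "integrable ?M (\<lambda>x. \<bar>?t w' x * (if \<bar>x - z\<bar> < e then 0 else 1)\<bar>)"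
            by (intro integrable_abs integrable_mult_bounded_interval[OF integrable_arch_over_diff[OF w[OF w']], where B = 1])
               (auto intro!: borel_measurable_lebesgue_on_borel)
          have "0 \<le> (b - a) / \<delta>" using ab \<delta>(1) by simp
          then show "\<bar>?t w' x * (if \<bar>x - z\<bar> < e then 0 else 1)\<bar> \<le> (b - a) / \<delta>" if "x \<in> space ?M" for x
            using tB[OF w', of x] that by simp
        qed simp
        also have "\<dots> = (b - a) * ((b - a) / \<delta>)"
          using ab by (simp add: measure_restrict_space)
        finally have I: "\<bar>?I\<bar> \<le> (b - a) * ((b - a) / \<delta>)" .
        have A: "\<bar>trunc_int a b (arch a b) z e\<bar> \<le> \<bar>?L\<bar> + 1" using e0(2)[OF e] by (simp add: dist_real_def)
        have "\<bar>?T e w'\<bar> = \<bar>?I - trunc_int a b (arch a b) z e\<bar> / \<bar>w' - z\<bar>"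
          using trunc_int_arch_over_diff[OF w[OF w'] z] e by simp
        also have "\<dots> \<le> ?B"
        proof (rule frac_le)
          show "\<bar>?I - trunc_int a b (arch a b) z e\<bar> \<le> (b - a) * ((b - a) / \<delta>) + (\<bar>?L\<bar> + 1)"
            using I A by linarith
          show "0 \<le> (b - a) * ((b - a) / \<delta>) + (\<bar>?L\<bar> + 1)" using ab \<delta>(1) by simp
          show "\<delta> \<le> \<bar>w' - z\<bar>" using \<delta>(2)[OF w', of z] z by (simp add: abs_minus_commute)
        qed (use \<delta> in auto)
        finally show "norm (F w' * ?T e w') \<le> \<bar>F w'\<bar> * ?B"
          unfolding real_norm_def abs_mult by (intro mult_left_mono) auto
      qed
    qed
    then have "((\<lambda>e. 1 / pi * (LINT w|?N. F w * ?T e w)) \<longlongrightarrow> 1 / pi * (LINT w|?N. F w * (pi * (?E w / (w - z) - 1)))) (at_right 0)"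
      by (intro tendsto_mult tendsto_const)
    moreover have "1 / pi * (LINT w|?N. F w * (pi * (?E w / (w - z) - 1))) = (LINT w|?N. f w / (w - z)) - (LINT w|?N. F w)"
    proof -
      have "integrable ?N (\<lambda>w. f w * (1 / (w - z)))"
      proof (rule integrable_mult_bounded_interval[OF f, where B = "1 / \<delta>"])
        show "(\<lambda>w. 1 / (w - z)) \<in> borel_measurable ?N" by (rule borel_measurable_lebesgue_on_borel) measurable
        show "\<bar>1 / (w - z)\<bar> \<le> 1 / \<delta>" if "w \<in> {c..d}" for w
          using \<delta>(1) \<delta>(2)[OF that, of z] z by (simp add: abs_minus_commute frac_le)
      qed
      moreover have "(LINT w|?N. F w * (pi * (?E w / (w - z) - 1))) = (LINT w|?N. pi * (f w * (1 / (w - z)) - F w))"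
      proof (rule Bochner_Integration.integral_cong[OF refl])
        fix v assume "v \<in> space ?N"
        then have "?E v \<noteq> 0" using outer_root_nonzero[of a b v] w[of v] ab by simp
        then show "F v * (pi * (?E v / (v - z) - 1)) = pi * (f v * (1 / (v - z)) - F v)"
          unfolding F_def by (simp add: right_diff_distrib mult.commute[of pi])
      qed
      ultimately show ?thesis using Fi by simp
    qed
    moreover have "\<forall>\<^sub>F e in at_right 0. trunc_int a b g z e = 1 / pi * (LINT w|?N. F w * ?T e w)"
      using eventually_at_right_less[of "0::real"] by eventually_elim (rule fub)
    ultimately show ?thesis by (simp add: filterlim_cong)
  qed
  ultimately show ?thesis using that by blast
qed

subsection \<open>Reduction of the system to single intervals\<close>

lemma L2_on_interval_iff:
  "\<phi> \<in> L2_on {a..b} \<longleftrightarrow> \<phi> \<in> borel_measurable (lebesgue_on {a..b}) \<and>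
     integrable (lebesgue_on {a..b}) (\<lambda>x. (norm (\<phi> x))\<^sup>2)"
  by (simp add: L2_on_def set_borel_measurable_def set_integrable_def
      borel_measurable_restrict_space_iff integrable_restrict_space)

lemma L2_on_Re: "\<phi> \<in> L2_on {a..b} \<Longrightarrow> sq_integrable a b (\<lambda>x. Re (\<phi> x))"
  unfolding L2_on_interval_iff sq_integrable_def
proof (intro conjI)
  assume *: "\<phi> \<in> borel_measurable (lebesgue_on {a..b}) \<and> integrable (lebesgue_on {a..b}) (\<lambda>x. (norm (\<phi> x))\<^sup>2)"
  then have [measurable]: "\<phi> \<in> borel_measurable (lebesgue_on {a..b})" by blast
  show m: "(\<lambda>x. Re (\<phi> x)) \<in> borel_measurable (lebesgue_on {a..b})" by measurable
  show "integrable (lebesgue_on {a..b}) (\<lambda>x. (Re (\<phi> x))\<^sup>2)"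
  proof (rule Bochner_Integration.integrable_bound)
    show "AE x in lebesgue_on {a..b}. norm ((Re (\<phi> x))\<^sup>2) \<le> norm ((norm (\<phi> x))\<^sup>2)"
      by (intro AE_I2) (auto simp: cmod_power2)
  qed (use * m in auto)
qed

lemma L2_on_of_real: "sq_integrable a b g \<Longrightarrow> (\<lambda>x. complex_of_real (g x)) \<in> L2_on {a..b}"
  unfolding L2_on_interval_iff sq_integrable_def by auto

lemma L2_on_integrable:
  assumes "\<phi> \<in> L2_on {a..b}"
  shows "integrable (lebesgue_on {a..b}) \<phi>"
proof -
  have m [measurable]: "\<phi> \<in> borel_measurable (lebesgue_on {a..b})"
    using assms by (simp add: L2_on_interval_iff)
  have "(\<lambda>x. norm (\<phi> x)) \<in> borel_measurable (lebesgue_on {a..b})" by measurable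
  then have "sq_integrable a b (\<lambda>x. norm (\<phi> x))"
    using assms by (simp add: L2_on_interval_iff sq_integrable_def)
  from sq_integrable_imp_integrable[OF this] show ?thesis
    using m by (rule Bochner_Integration.integrable_bound) simp
qed

lemma integrable_mult_of_real_bounded:
  fixes g :: "real \<Rightarrow> real" and \<phi> :: "real \<Rightarrow> complex"
  assumes \<phi>: "integrable (lebesgue_on {a..b}) \<phi>" and g: "g \<in> borel_measurable borel"
    and B: "\<And>x. x \<in> {a..b} \<Longrightarrow> \<bar>g x\<bar> \<le> B"
  shows "integrable (lebesgue_on {a..b}) (\<lambda>x. \<phi> x * complex_of_real (g x))"
proof (rule Bochner_Integration.integrable_bound)
  have gm: "g \<in> borel_measurable (lebesgue_on {a..b})" by (rule borel_measurable_lebesgue_on_borel[OF g])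
  show "integrable (lebesgue_on {a..b}) (\<lambda>x. norm (\<phi> x) * g x)"
    by (rule integrable_mult_bounded_interval[OF integrable_norm[OF \<phi>] gm B])
  show "(\<lambda>x. \<phi> x * complex_of_real (g x)) \<in> borel_measurable (lebesgue_on {a..b})"
    using gm \<phi> by auto
qed (simp add: norm_mult)

lemma truncated_cauchy_integral_eq:
  "truncated_cauchy_integral a b \<phi> z e = (LINT x|lebesgue_on {a..b}. \<phi> x * complex_of_real (kern e (x - z)))"
proof -
  have "indicator ({a..b} - {z - e<..<z + e}) x *\<^sub>R (\<phi> x / complex_of_real (x - z))
     = indicator {a..b} x *\<^sub>R (\<phi> x * complex_of_real (kern e (x - z)))" for x
    by (auto simp: indicator_def kern_def)
  then show ?thesis
    unfolding truncated_cauchy_integral_def set_lebesgue_integral_def by (simp add: integral_restrict_space)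
qed

lemma Re_truncated_cauchy_integral:
  assumes "\<phi> \<in> L2_on {a..b}" "e > 0"
  shows "Re (truncated_cauchy_integral a b \<phi> z e) = trunc_int a b (\<lambda>x. Re (\<phi> x)) z e"
proof -
  have "integrable (lebesgue_on {a..b}) (\<lambda>x. \<phi> x * complex_of_real (kern e (x - z)))"
    by (rule integrable_mult_of_real_bounded[OF L2_on_integrable[OF assms(1)] _ abs_kern_le[OF assms(2)]]) measurable
  from integral_bounded_linear[OF bounded_linear_Re this] show ?thesis
    unfolding truncated_cauchy_integral_eq trunc_int_def by simp
qed

lemma truncated_cauchy_integral_of_real:
  "truncated_cauchy_integral a b (\<lambda>x. complex_of_real (g x)) z e = complex_of_real (trunc_int a b g z e)"
  unfolding truncated_cauchy_integral_eq trunc_int_def of_real_mult[symmetric] by (rule integral_complex_of_real)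

text \<open>The factor \<open>pi\<close> undoes the normalisation of \<open>hilbert\<close>, which
  \<open>trunc_int\<close> does not carry.\<close>

lemma tendsto_trunc_int_Re:
  assumes \<phi>: "\<phi> \<in> L2_on {a..b}" and "hilbert_exists a b \<phi> z" and z: "z \<in> {a..b}"
  shows "(trunc_int a b (\<lambda>x. Re (\<phi> x)) z \<longlongrightarrow> pi * Re (hilbert a b \<phi> z)) (at_right 0)"
proof -
  obtain w where w: "(truncated_cauchy_integral a b \<phi> z \<longlongrightarrow> w) (at_right 0)"
    using assms by (auto simp: hilbert_exists_def)
  have "hilbert a b \<phi> z = complex_of_real (1 / pi) * w"
    using z tendsto_Lim[OF trivial_limit_at_right_real w] by (simp add: hilbert_def)
  then have "pi * Re (hilbert a b \<phi> z) = Re w" by simp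
  moreover have "\<forall>\<^sub>F e in at_right 0. Re (truncated_cauchy_integral a b \<phi> z e) = trunc_int a b (\<lambda>x. Re (\<phi> x)) z e"
    using eventually_at_right_less[of "0::real"] by eventually_elim (rule Re_truncated_cauchy_integral[OF \<phi>])
  ultimately show ?thesis using tendsto_Re[OF w] by (simp add: filterlim_cong)
qed

lemma hilbert_of_real:
  assumes "(trunc_int a b g z \<longlongrightarrow> pi * l) (at_right 0)" and z: "z \<in> {a..b}"
  shows "hilbert_exists a b (\<lambda>x. complex_of_real (g x)) z"
    and "hilbert a b (\<lambda>x. complex_of_real (g x)) z = complex_of_real l"
proof -
  have t: "(truncated_cauchy_integral a b (\<lambda>x. complex_of_real (g x)) z \<longlongrightarrow> complex_of_real (pi * l)) (at_right 0)"
    unfolding truncated_cauchy_integral_of_real by (rule tendsto_of_real[OF assms(1)])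
  then show "hilbert_exists a b (\<lambda>x. complex_of_real (g x)) z" by (auto simp: hilbert_exists_def)
  show "hilbert a b (\<lambda>x. complex_of_real (g x)) z = complex_of_real l"
    using z tendsto_Lim[OF trivial_limit_at_right_real t] by (simp add: hilbert_def)
qed

lemma Re_hilbert_exterior:
  assumes \<phi>: "\<phi> \<in> L2_on {c..d}" and z: "z \<notin> {c..d}"
  shows "pi * Re (hilbert c d \<phi> z) = (LINT w|lebesgue_on {c..d}. Re (\<phi> w) / (w - z))"
proof -
  obtain \<delta> where \<delta>: "\<delta> > 0" "\<And>w. w \<in> {c..d} \<Longrightarrow> \<delta> \<le> \<bar>z - w\<bar>"
  proof (cases "d < c")
    \<comment> \<open>The interval is empty, so any positive number will do.\<close>
    case True
    then show ?thesis by (intro that[of 1]) auto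
  next
    case False
    then have "d < z \<or> z < c" using z by auto
    \<comment> \<open>The point \<open>z\<close> is treated as the interval
      \<open>{z..z}\<close>.\<close>
    then show ?thesis using separated_intervals[of d z z c] that by (metis atLeastAtMost_iff order_refl)
  qed
  have "integrable (lebesgue_on {c..d}) (\<lambda>w. \<phi> w * complex_of_real (1 / (w - z)))"
  proof (rule integrable_mult_of_real_bounded[OF L2_on_integrable[OF \<phi>], where B = "1 / \<delta>"])
    show "\<bar>1 / (w - z)\<bar> \<le> 1 / \<delta>" if "w \<in> {c..d}" for w
      using \<delta>(1) \<delta>(2)[OF that] by (simp add: abs_minus_commute frac_le)
  qed measurable
  from integral_bounded_linear[OF bounded_linear_Re this]
  have "(LINT w|lebesgue_on {c..d}. Re (\<phi> w) / (w - z)) = Re (LINT w|lebesgue_on {c..d}. \<phi> w / complex_of_real (w - z))"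
    by (simp add: Re_divide_of_real)
  also have "\<dots> = pi * Re (hilbert c d \<phi> z)"
    unfolding hilbert_def using z by (simp only: if_False) (simp add: set_lebesgue_integral_def integral_restrict_space)
  finally show ?thesis by simp
qed

lemma trunc_int_sum:
  assumes "finite I" "\<And>i. i \<in> I \<Longrightarrow> sq_integrable a b (f i)" "e > 0"
  shows "trunc_int a b (\<lambda>x. \<Sum>i\<in>I. c i * f i x) z e = (\<Sum>i\<in>I. c i * trunc_int a b (f i) z e)"
proof -
  have "trunc_int a b (\<lambda>x. \<Sum>i\<in>I. c i * f i x) z e = (LINT x|lebesgue_on {a..b}. (\<Sum>i\<in>I. c i * (f i x * kern e (x - z))))"
    by (simp add: trunc_int_def sum_distrib_right mult.assoc)
  also have "\<dots> = (\<Sum>i\<in>I. (LINT x|lebesgue_on {a..b}. c i * (f i x * kern e (x - z))))"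
    using assms by (intro Bochner_Integration.integral_sum integrable_mult_right integrable_times_kern sq_integrable_imp_integrable) auto
  finally show ?thesis by (simp add: trunc_int_def)
qed

lemma tendsto_trunc_int_sum:
  assumes "finite I" "\<And>i. i \<in> I \<Longrightarrow> sq_integrable a b (f i)"
    and "\<And>i. i \<in> I \<Longrightarrow> (trunc_int a b (f i) z \<longlongrightarrow> l i) (at_right 0)"
  shows "(trunc_int a b (\<lambda>x. \<Sum>i\<in>I. c i * f i x) z \<longlongrightarrow> (\<Sum>i\<in>I. c i * l i)) (at_right 0)"
proof -
  have "((\<lambda>e. \<Sum>i\<in>I. c i * trunc_int a b (f i) z e) \<longlongrightarrow> (\<Sum>i\<in>I. c i * l i)) (at_right 0)"
    by (intro tendsto_sum tendsto_mult tendsto_const assms(3))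
  moreover have "\<forall>\<^sub>F e in at_right 0. trunc_int a b (\<lambda>x. \<Sum>i\<in>I. c i * f i x) z e = (\<Sum>i\<in>I. c i * trunc_int a b (f i) z e)"
    using eventually_at_right_less[of "0::real"] by eventually_elim (rule trunc_int_sum[OF assms(1,2)])
  ultimately show ?thesis by (simp add: filterlim_cong)
qed

lemma AE_lebesgue_on_interval_iff:
  "(AE z in lebesgue. z \<in> {a..b::real} \<longrightarrow> P z) \<longleftrightarrow> (AE z in lebesgue_on {a..b}. P z)"
  by (subst AE_restrict_space_iff) auto

text \<open>Every summand of the row is, up to a constant, a transform on the single interval of
  index \<open>m\<close>: the summand \<open>k = m\<close> by definition, the others by
  \<open>pv_solution_exterior\<close>. Linearity then assembles one preimage
  \<open>g\<close>.\<close>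

lemma hilbert_system_row:
  fixes \<alpha> \<beta> :: "'n::{finite,linorder} \<Rightarrow> real"
  assumes int: "ordered_intervals \<alpha> \<beta>" and sol: "solves_hilbert_system \<Theta> \<alpha> \<beta> (\<lambda>j x. complex_of_real (\<psi> j x)) \<phi>"
  shows "\<exists>c g. sq_integrable (\<alpha> m) (\<beta> m) g \<and>
    (AE z in lebesgue_on {\<alpha> m..\<beta> m}. (trunc_int (\<alpha> m) (\<beta> m) g z \<longlongrightarrow> pi * (\<psi> m z - c)) (at_right 0))"
proof -
  have ab: "\<alpha> m < \<beta> m" using int by (auto simp: ordered_intervals_def)
  have sep: "\<beta> k < \<alpha> m \<or> \<beta> m < \<alpha> k" if "k \<noteq> m" for k
    using int that by (meson ordered_intervals_def neqE)
  have \<phi>: "\<phi> k \<in> L2_on {\<alpha> k..\<beta> k}" for k using sol by (simp add: solves_hilbert_system_def L2_vec_def)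
  let ?X = "\<lambda>k z. pi * Re (hilbert (\<alpha> k) (\<beta> k) (\<phi> k) z)"
  have "\<exists>h \<kappa>. sq_integrable (\<alpha> m) (\<beta> m) h \<and> (\<forall>z\<in>{\<alpha> m<..<\<beta> m}. hilbert_exists (\<alpha> k) (\<beta> k) (\<phi> k) z \<longrightarrow>
      (trunc_int (\<alpha> m) (\<beta> m) h z \<longlongrightarrow> ?X k z - \<kappa>) (at_right 0))" for k
  proof (cases "k = m")
    case True
    have "(trunc_int (\<alpha> m) (\<beta> m) (\<lambda>x. Re (\<phi> m x)) z \<longlongrightarrow> ?X m z - 0) (at_right 0)"
      if "z \<in> {\<alpha> m<..<\<beta> m}" "hilbert_exists (\<alpha> m) (\<beta> m) (\<phi> m) z" for z
      using tendsto_trunc_int_Re[OF \<phi> that(2)] that(1) by simp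
    then show ?thesis unfolding True using L2_on_Re[OF \<phi>] by blast
  next
    case False
    obtain h \<kappa> where h: "sq_integrable (\<alpha> m) (\<beta> m) h"
      "\<And>z. z \<in> {\<alpha> m<..<\<beta> m} \<Longrightarrow> (trunc_int (\<alpha> m) (\<beta> m) h z \<longlongrightarrow>
        (LINT w|lebesgue_on {\<alpha> k..\<beta> k}. Re (\<phi> k w) / (w - z)) - \<kappa>) (at_right 0)"
      by (rule pv_solution_exterior[OF ab sep[OF False] sq_integrable_imp_integrable[OF L2_on_Re[OF \<phi>]]])
         (rule that, assumption, blast)
    have "?X k z = (LINT w|lebesgue_on {\<alpha> k..\<beta> k}. Re (\<phi> k w) / (w - z))" if "z \<in> {\<alpha> m<..<\<beta> m}" for z
      by (rule Re_hilbert_exterior[OF \<phi>]) (use that sep[OF False] in auto)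
    with h show ?thesis by (intro exI[of _ h] exI[of _ \<kappa>]) simp
  qed
  then obtain h \<kappa> where h: "\<And>k. sq_integrable (\<alpha> m) (\<beta> m) (h k)"
    "\<And>k z. z \<in> {\<alpha> m<..<\<beta> m} \<Longrightarrow> hilbert_exists (\<alpha> k) (\<beta> k) (\<phi> k) z \<Longrightarrow>
      (trunc_int (\<alpha> m) (\<beta> m) (h k) z \<longlongrightarrow> ?X k z - \<kappa> k) (at_right 0)"
    by metis
  define g where "g = (\<lambda>x. \<Sum>k\<in>UNIV. \<Theta> $ m $ k * h k x)"
  \<comment> \<open>Divided by \<open>pi\<close> because each \<open>\<kappa> k\<close> belongs to
    the limit of \<open>trunc_int\<close>, which is \<open>pi\<close> times the transform.\<close>
  define c where "c = (\<Sum>k\<in>UNIV. \<Theta> $ m $ k * \<kappa> k) / pi"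
  have "AE z in lebesgue_on {\<alpha> m..\<beta> m}. (\<forall>k. hilbert_exists (\<alpha> k) (\<beta> k) (\<phi> k) z) \<and>
      (\<Sum>k\<in>UNIV. of_real (\<Theta> $ m $ k) * hilbert (\<alpha> k) (\<beta> k) (\<phi> k) z) = complex_of_real (\<psi> m z)"
    using sol by (simp only: solves_hilbert_system_def AE_lebesgue_on_interval_iff)
  then have "AE z in lebesgue_on {\<alpha> m..\<beta> m}. (trunc_int (\<alpha> m) (\<beta> m) g z \<longlongrightarrow> pi * (\<psi> m z - c)) (at_right 0)"
    using AE_interior_interval
  proof eventually_elim
    case (elim z)
    have "(trunc_int (\<alpha> m) (\<beta> m) g z \<longlongrightarrow> (\<Sum>k\<in>UNIV. \<Theta> $ m $ k * (?X k z - \<kappa> k))) (at_right 0)"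
      unfolding g_def using elim by (intro tendsto_trunc_int_sum h) auto
    moreover have "(\<Sum>k\<in>UNIV. \<Theta> $ m $ k * (?X k z - \<kappa> k)) = pi * (\<psi> m z - c)"
    proof -
      have "\<psi> m z = Re (\<Sum>k\<in>UNIV. of_real (\<Theta> $ m $ k) * hilbert (\<alpha> k) (\<beta> k) (\<phi> k) z)"
        using elim(1) by simp
      then have "pi * \<psi> m z = (\<Sum>k\<in>UNIV. \<Theta> $ m $ k * ?X k z)"
        by (simp add: sum_distrib_left mult_ac)
      then show ?thesis by (simp add: c_def right_diff_distrib sum_subtractf)
    qed
    ultimately show ?case by simp
  qed
  moreover have "sq_integrable (\<alpha> m) (\<beta> m) g"
    unfolding g_def by (intro sq_integrable_sum sq_integrable_cmult h) simp
  ultimately show ?thesis by blast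
qed

text \<open>In the difference of the two preimages \<open>\<psi>\<close> cancels, so its transform
  is the constant \<open>c' j - c j\<close>, to which \<open>pv_const_eq_0\<close> applies.\<close>

lemma hilbert_range_const_unique:
  assumes int: "ordered_intervals \<alpha> \<beta>"
    and c: "(\<lambda>j x. complex_of_real (\<psi> j x) - complex_of_real (c j)) \<in> hilbert_range \<alpha> \<beta>"
    and c': "(\<lambda>j x. complex_of_real (\<psi> j x) - complex_of_real (c' j)) \<in> hilbert_range \<alpha> \<beta>"
  shows "c j = c' j"
proof -
  let ?a = "\<alpha> j" and ?b = "\<beta> j"
  have *: "\<exists>f. sq_integrable ?a ?b f \<and> (AE z in lebesgue_on {?a..?b}. (trunc_int ?a ?b f z \<longlongrightarrow> pi * (\<psi> j z - c j)) (at_right 0))"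
    if c: "(\<lambda>j x. complex_of_real (\<psi> j x) - complex_of_real (c j)) \<in> hilbert_range \<alpha> \<beta>" for c
  proof -
    obtain \<phi> where \<phi>: "\<phi> j \<in> L2_on {?a..?b}"
      "AE z in lebesgue_on {?a..?b}. hilbert_exists ?a ?b (\<phi> j) z \<and>
        hilbert ?a ?b (\<phi> j) z = complex_of_real (\<psi> j z) - complex_of_real (c j)"
      using c by (auto simp only: hilbert_range_def L2_vec_def AE_lebesgue_on_interval_iff)
    from \<phi>(2) AE_interior_interval
    have "AE z in lebesgue_on {?a..?b}. (trunc_int ?a ?b (\<lambda>x. Re (\<phi> j x)) z \<longlongrightarrow> pi * (\<psi> j z - c j)) (at_right 0)"
    proof eventually_elim
      case (elim z)
      then show ?case using tendsto_trunc_int_Re[OF \<phi>(1), of z] by simp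
    qed
    then show ?thesis using L2_on_Re[OF \<phi>(1)] by blast
  qed
  from *[OF c] *[OF c'] obtain f f' where f: "sq_integrable ?a ?b f" "sq_integrable ?a ?b f'"
    and lim: "AE z in lebesgue_on {?a..?b}. (trunc_int ?a ?b f z \<longlongrightarrow> pi * (\<psi> j z - c j)) (at_right 0)"
      "AE z in lebesgue_on {?a..?b}. (trunc_int ?a ?b f' z \<longlongrightarrow> pi * (\<psi> j z - c' j)) (at_right 0)"
    by blast
  \<comment> \<open>The difference \<open>f - f'\<close>, written as a sum over two indices so that
    \<open>tendsto_trunc_int_sum\<close> covers it.\<close>
  let ?F = "\<lambda>x. \<Sum>i\<in>{True, False}. (if i then 1 else - 1) * (if i then f else f') x"
  have "AE z in lebesgue_on {?a..?b}. (trunc_int ?a ?b ?F z \<longlongrightarrow> pi * (c' j - c j)) (at_right 0)"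
    using lim
  proof eventually_elim
    case (elim z)
    have "(trunc_int ?a ?b ?F z \<longlongrightarrow> (\<Sum>i\<in>{True, False}. (if i then 1 else - 1) * (if i then pi * (\<psi> j z - c j) else pi * (\<psi> j z - c' j)))) (at_right 0)"
      by (rule tendsto_trunc_int_sum) (use f elim in auto)
    then show ?case by (simp add: algebra_simps)
  qed
  moreover have "sq_integrable ?a ?b ?F"
    by (intro sq_integrable_sum sq_integrable_cmult) (use f in auto)
  ultimately have "pi * (c' j - c j) = 0"
    using int by (intro pv_const_eq_0[of ?a ?b ?F]) (auto simp: ordered_intervals_def)
  then show ?thesis by simp
qed

theorem lemma2p3:
  fixes \<alpha> \<beta> :: "'n::{finite,linorder} \<Rightarrow> real"
    and \<Theta> :: "real ^ 'n::{finite,linorder} ^ 'n::{finite,linorder}"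
    and \<psi> :: "'n \<Rightarrow> real \<Rightarrow> real"
  assumes "ordered_intervals \<alpha> \<beta>"
    and "invertible (diag_part \<Theta>)"
    and "(\<lambda>j x. complex_of_real (\<psi> j x)) \<in> L2_vec \<alpha> \<beta>"
    and "\<exists>\<phi>. solves_hilbert_system \<Theta> \<alpha> \<beta> (\<lambda>j x. complex_of_real (\<psi> j x)) \<phi>"
  shows "\<exists>!c :: real ^ 'n::{finite,linorder}. (\<lambda>j x. complex_of_real (\<psi> j x) - complex_of_real (c $ j)) \<in> hilbert_range \<alpha> \<beta>"
proof -
  obtain \<phi> where "solves_hilbert_system \<Theta> \<alpha> \<beta> (\<lambda>j x. complex_of_real (\<psi> j x)) \<phi>"
    using assms(4) by blast
  then have "\<forall>m. \<exists>c g. sq_integrable (\<alpha> m) (\<beta> m) g \<and>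
    (AE z in lebesgue_on {\<alpha> m..\<beta> m}. (trunc_int (\<alpha> m) (\<beta> m) g z \<longlongrightarrow> pi * (\<psi> m z - c)) (at_right 0))"
    by (intro allI hilbert_system_row[OF assms(1)])
  from choice[OF this] obtain c where "\<forall>m. \<exists>g. sq_integrable (\<alpha> m) (\<beta> m) g \<and>
    (AE z in lebesgue_on {\<alpha> m..\<beta> m}. (trunc_int (\<alpha> m) (\<beta> m) g z \<longlongrightarrow> pi * (\<psi> m z - c m)) (at_right 0))" ..
  from choice[OF this] obtain g where "\<forall>m. sq_integrable (\<alpha> m) (\<beta> m) (g m) \<and>
    (AE z in lebesgue_on {\<alpha> m..\<beta> m}. (trunc_int (\<alpha> m) (\<beta> m) (g m) z \<longlongrightarrow> pi * (\<psi> m z - c m)) (at_right 0))" ..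
  then have g: "sq_integrable (\<alpha> m) (\<beta> m) (g m)"
    and lim: "AE z in lebesgue_on {\<alpha> m..\<beta> m}. (trunc_int (\<alpha> m) (\<beta> m) (g m) z \<longlongrightarrow> pi * (\<psi> m z - c m)) (at_right 0)" for m
    by simp_all
  have \<psi>: "sq_integrable (\<alpha> j) (\<beta> j) (\<psi> j)" for j
    using assms(3) L2_on_Re[of "\<lambda>x. complex_of_real (\<psi> j x)"] by (simp add: L2_vec_def)
  have "(\<lambda>j x. complex_of_real (\<psi> j x) - complex_of_real (vec_lambda c $ j)) \<in> hilbert_range \<alpha> \<beta>"
    unfolding hilbert_range_def L2_vec_def AE_lebesgue_on_interval_iff vec_lambda_beta of_real_diff[symmetric]
  proof (intro CollectI conjI allI bexI[of _ "\<lambda>j x. complex_of_real (g j x)"])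
    fix j
    show "(\<lambda>x. complex_of_real (\<psi> j x - c j)) \<in> L2_on {\<alpha> j..\<beta> j}"
      by (intro L2_on_of_real sq_integrable_diff \<psi> sq_integrable_const)
    show "(\<lambda>x. complex_of_real (g j x)) \<in> L2_on {\<alpha> j..\<beta> j}"
      by (intro L2_on_of_real g)
    show "AE z in lebesgue_on {\<alpha> j..\<beta> j}. hilbert_exists (\<alpha> j) (\<beta> j) (\<lambda>x. complex_of_real (g j x)) z \<and>
       hilbert (\<alpha> j) (\<beta> j) (\<lambda>x. complex_of_real (g j x)) z = complex_of_real (\<psi> j z - c j)"
      using lim[of j] AE_interior_interval
    proof eventually_elim
      case (elim z)
      then show ?case using hilbert_of_real[OF elim(1)] by simp
    qed
  qed
  moreover have "c1 = c2"
    if "(\<lambda>j x. complex_of_real (\<psi> j x) - complex_of_real (c1 $ j)) \<in> hilbert_range \<alpha> \<beta>"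
      "(\<lambda>j x. complex_of_real (\<psi> j x) - complex_of_real (c2 $ j)) \<in> hilbert_range \<alpha> \<beta>" for c1 c2 :: "real ^ 'n::{finite,linorder}"
    using hilbert_range_const_unique[OF assms(1) that] by (simp add: vec_eq_iff)
  ultimately show ?thesis by blast
qed

end
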